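(* The complete binomial products $\overline{G}_n = \prod_{j=1}^n \binom{n}{j}$ have an asymptotic expansion for $\log(\overline{G}_n)$ to any given order $N \ge 1$, valid uniformly for all integers $n \ge 2$, of the form $$\log(\overline{G}_n) = \frac{1}{2} n^2 - \frac{1}{2} n \log n + \left(1 - \frac{1}{2}\log(2\pi)\right) n - \frac{1}{3}\log n + g_0 + \sum_{j=1}^N g_j \frac{1}{n^j} + O\left(\frac{1}{n^{N+1}}\right).$$ Here $g_0 = -\frac{1}{2}\log(2\pi) - \frac{1}{12} + 2\log A$, where $A$ is the Glaisher–Kinkelin constant; for $j \ge 1$ the coefficients $g_j$ are explicitly computable rational numbers; and the implied $O$-constant depends on $N$.
   Context: The Glaisher–Kinkelin constant is $A = \exp\big(\frac{1}{12} - \zeta'(-1)\big)$, where $\zeta$ is the Riemann zeta function. The coefficients $g_j$ do not depend on $n$ or $N$. *)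

theory Defs
  imports "HOL-Complex_Analysis.Complex_Analysis"
begin

definition binomial_product :: "nat \<Rightarrow> nat" where
  "binomial_product n = (\<Prod>j = 1..n. n choose j)"

text \<open>
  The Riemann zeta function is the holomorphic continuation of the Dirichlet series
  \<open>1\<^sup>-\<^sup>s + 2\<^sup>-\<^sup>s + 3\<^sup>-\<^sup>s + \<dots>\<close> to the complex plane without the point 1. Its value
  at the pole is set to 0, so that the description determines the function everywhere.
\<close>

definition is_zeta_continuation :: "(complex \<Rightarrow> complex) \<Rightarrow> bool" where
  "is_zeta_continuation f \<longleftrightarrow>
     f holomorphic_on (- {1}) \<and> f 1 = 0 \<and>
     (\<forall>s. Re s > 1 \<longrightarrow> (\<lambda>n. 1 / of_nat (Suc n) powr s) sums f s)"

lemma is_zeta_continuation_unique: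
  assumes "is_zeta_continuation f" "is_zeta_continuation g"
  shows "f = g"
proof
  fix s :: complex
  show "f s = g s"
  proof (cases "s = 1")
    case True
    then show ?thesis using assms by (simp add: is_zeta_continuation_def)
  next
    case False
    have holo: "(\<lambda>z. f z - g z) holomorphic_on (- {1})"
      using assms by (auto simp: is_zeta_continuation_def intro!: holomorphic_intros)
    have conn: "connected (- {1 :: complex})"
      by (rule connected_punctured_universe) simp
    have eq: "f z - g z = 0" if "z \<in> {z. Re z > 1}" for z
      using that assms sums_unique2 by (fastforce simp: is_zeta_continuation_def)
    have "f s - g s = 0"
    proof (rule analytic_continuation_open[where f = "\<lambda>z. f z - g z" and g = "\<lambda>_. 0"])
      show "open {z. Re z > 1}" by (rule open_halfspace_Re_gt)
      show "{z. Re z > 1} \<noteq> {}" by (auto intro!: exI[of _ 2])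
      show "{z. Re z > 1} \<subseteq> - {1}" by auto
    qed (use holo conn eq False in auto)
    then show ?thesis by simp
  qed
qed

definition riemann_zeta :: "complex \<Rightarrow> complex" where
  "riemann_zeta = (THE f. is_zeta_continuation f)"

text \<open>\<open>riemann_zeta\<close> is real on the real axis, so taking the real part of its derivative at
  \<open>-1\<close> is only a change of type.\<close>

definition glaisher_kinkelin :: real where
  "glaisher_kinkelin = exp (1 / 12 - Re (deriv riemann_zeta (- 1)))"

text \<open>
  Total (general) recursive functions in the sense of Kleene. Arguments are passed as a list
  in which missing entries count as 0, so that no arities need to be tracked. In the rule
  \<open>minimization\<close> the search is required to succeed on all arguments, which is what keeps the
  functions total.
\<close>

definition arg :: "nat \<Rightarrow> nat list \<Rightarrow> nat" where
  "arg i xs = (if i < length xs then xs ! i else 0)"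

inductive recursive_function :: "(nat list \<Rightarrow> nat) \<Rightarrow> bool" where
  zero: "recursive_function (\<lambda>xs. 0)"
| successor: "recursive_function (\<lambda>xs. Suc (arg 0 xs))"
| projection: "recursive_function (arg i)"
| composition:
    "recursive_function f \<Longrightarrow> (\<And>g. g \<in> set gs \<Longrightarrow> recursive_function g) \<Longrightarrow>
     recursive_function (\<lambda>xs. f (map (\<lambda>g. g xs) gs))"
| primitive_recursion:
    "recursive_function f \<Longrightarrow> recursive_function h \<Longrightarrow>
     recursive_function (\<lambda>xs. rec_nat (f (tl xs)) (\<lambda>y r. h (y # r # tl xs)) (arg 0 xs))"
| minimization:
    "recursive_function f \<Longrightarrow> (\<And>xs. \<exists>y. f (y # xs) = 0) \<Longrightarrow>
     recursive_function (\<lambda>xs. LEAST y. f (y # xs) = 0)"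

definition computable_nat_seq :: "(nat \<Rightarrow> nat) \<Rightarrow> bool" where
  "computable_nat_seq a \<longleftrightarrow> recursive_function (\<lambda>xs. a (arg 0 xs))"

text \<open>A sequence of rationals is computable if it is a quotient of computable integer sequences;
  the integer numerator is given as a difference of two naturals.\<close>

definition computable_rat_seq :: "(nat \<Rightarrow> rat) \<Rightarrow> bool" where
  "computable_rat_seq g \<longleftrightarrow>
     (\<exists>a b c. computable_nat_seq a \<and> computable_nat_seq b \<and> computable_nat_seq c \<and>
        (\<forall>j. c j > 0 \<and> g j = (of_nat (a j) - of_nat (b j)) / of_nat (c j)))"

end

theory Submission
  imports Defs
begin

text \<open>The identity $\overline{G}_n = \prod_{k\le n} k^{2k} / (n!)^{n+1}$ reduces the claim to expansions of
  $\log n!$ and of the logarithm $\sum_{k\le n} k\log k$ of the hyperfactorial. Both sums are minus the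
  derivative in \<open>s\<close> of $\sum_{k\le n} k^{-s}$, at \<open>s = 0\<close> and at \<open>s = -1\<close>, so both expansions come
  from one source: the Euler-Maclaurin approximation
  \[ \zeta(s) \approx \sum_{k<n} k^{-s} -
     \sum_{j\le N} \frac{B_j}{1-s} {1-s \choose j} n^{1-s-j}. \]

  Consecutive values of the right-hand side differ by $O(n^{-\Re s-N-1})$, locally uniformly in \<open>s\<close>:
  expanding $(n+1)^{1-s-j}$ in powers of $1/n$, the coefficients cancel by the recurrence
  $\sum_{j\le m} {m+1\choose j} B_j = [m = 0]$ (\<open>euler_maclaurin_coeff_recurrence\<close>,
  \<open>zeta_approx_step_bound\<close>). Hence the right-hand side converges for $\Re s > -N$, and since \<open>N\<close> is
  arbitrary the limits form the analytic continuation of the zeta function to the plane without 1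
  (\<open>riemann_zeta_eq_zeta_continuation\<close>). The convergence has a rate that is uniform on discs, so
  Cauchy's inequality transfers it to derivatives (\<open>deriv_zeta_approx_rate\<close>). At \<open>0\<close> and \<open>-1\<close> all
  but finitely many of the coefficients vanish, and their derivatives are explicit. This gives the two
  expansions with constants $-\zeta'(0)$ and $\frac1{12}-\zeta'(-1) = \log A$; the first constant is
  identified as $\frac12\log(2\pi)$ by Wallis' product.

  The coefficients come out as $g_j = (-1)^j (B_{j+1} - B_{j+2}) / (j(j+1))$. For their computability the
  Bernoulli numbers are defined by the explicit double sum
  $B_m = \sum_{k\le m} \frac1{k+1} \sum_{r\le k} (-1)^r {k\choose r} r^m$: rational-valued functions
  that are quotients of recursive functions are closed under arithmetic and under finite sums of
  variable length, so no recursion over the whole history of a sequence has to be encoded.\<close>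

section \<open>Bernoulli numbers\<close>

text \<open>The explicit formula gives the convention $B_1 = -\frac12$. It is the one that suits sums over
  \<open>k < n\<close>, with the endpoint \<open>n\<close> left out.\<close>
definition bernoulli_number :: "nat \<Rightarrow> rat" where
  "bernoulli_number m =
     (\<Sum>k<Suc m. (\<Sum>r<Suc k. (-1) ^ r * of_nat (k choose r) * of_nat r ^ m) / of_nat (Suc k))"

text \<open>Pascal's rule turns an alternating binomial sum of order \<open>k + 1\<close> into one of order \<open>k\<close> of the
  forward difference, and absorption does the same with \<open>r * f r\<close> and the shift of \<open>f\<close>.\<close>
lemma alternating_binomial_sum_shift:
  fixes f :: "nat \<Rightarrow> rat"
  shows "(\<Sum>r\<le>Suc k. (-1) ^ r * of_nat (Suc k choose r) * f r) =
         - (\<Sum>r\<le>k. (-1) ^ r * of_nat (k choose r) * (f (Suc r) - f r))"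
proof -
  have "(\<Sum>r\<le>Suc k. (-1) ^ r * of_nat (Suc k choose r) * f r) =
        f 0 + (\<Sum>r\<le>k. (-1) ^ Suc r * of_nat (k choose r) * f (Suc r)
             + (-1) ^ Suc r * of_nat (k choose Suc r) * f (Suc r))"
    by (subst sum.atMost_Suc_shift) (simp add: algebra_simps)
  also have "\<dots> = (\<Sum>r\<le>k. (-1) ^ Suc r * of_nat (k choose r) * f (Suc r))
      + (f 0 + (\<Sum>r\<le>k. (-1) ^ Suc r * of_nat (k choose Suc r) * f (Suc r)))"
    by (simp only: sum.distrib ac_simps)
  also have "f 0 + (\<Sum>r\<le>k. (-1) ^ Suc r * of_nat (k choose Suc r) * f (Suc r)) =
      (\<Sum>r\<le>Suc k. (-1) ^ r * of_nat (k choose r) * f r)"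
    by (subst sum.atMost_Suc_shift) simp
  also have "\<dots> = (\<Sum>r\<le>k. (-1) ^ r * of_nat (k choose r) * f r)"
    by (simp add: binomial_eq_0)
  finally show ?thesis
    by (simp add: sum_negf sum_subtractf algebra_simps)
qed

lemma alternating_binomial_sum_absorb:
  fixes f :: "nat \<Rightarrow> rat"
  shows "(\<Sum>r\<le>Suc k. (-1) ^ r * of_nat (Suc k choose r) * (of_nat r * f r)) =
         - of_nat (Suc k) * (\<Sum>r\<le>k. (-1) ^ r * of_nat (k choose r) * f (Suc r))"
proof -
  have *: "of_nat (Suc k choose Suc r) * of_nat (Suc r) = of_nat (Suc k) * (of_nat (k choose r) :: rat)" for r
    using binomial_absorption[of r "Suc k"]
    by (metis diff_Suc_1 mult.commute of_nat_mult)
  have "(\<Sum>r\<le>Suc k. (-1) ^ r * of_nat (Suc k choose r) * (of_nat r * f r)) =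
     (\<Sum>r\<le>k. (-1) ^ Suc r * (of_nat (Suc k choose Suc r) * of_nat (Suc r)) * f (Suc r))"
    by (subst sum.atMost_Suc_shift) (simp add: mult.assoc)
  also have "\<dots> = (\<Sum>r\<le>k. - of_nat (Suc k) * ((-1) ^ r * of_nat (k choose r) * f (Suc r)))"
    by (simp only: *) (simp add: algebra_simps)
  finally show ?thesis by (simp only: sum_distrib_left)
qed

text \<open>The sum is, up to sign, the \<open>k\<close>-th forward difference at \<open>0\<close> of a polynomial of degree less than
  \<open>k\<close>. The proof lowers both \<open>k\<close> and the exponent by absorption.\<close>
lemma alternating_binomial_sum_power:
  assumes "m < k"
  shows "(\<Sum>r\<le>k. (-1) ^ r * of_nat (k choose r) * of_nat r ^ m) = (0 :: rat)"
  using assms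
proof (induction m arbitrary: k rule: less_induct)
  case (less m)
  then obtain k' where k: "k = Suc k'" by (cases k) auto
  show ?case
  proof (cases m)
    case 0
    then show ?thesis using choose_alternating_sum[of k, where 'a = rat] k by simp
  next
    case (Suc m')
    have "(\<Sum>r\<le>k'. (-1) ^ r * of_nat (k' choose r) * of_nat (Suc r) ^ m') =
        (\<Sum>r\<le>k'. \<Sum>j\<le>m'. of_nat (m' choose j) * ((-1) ^ r * of_nat (k' choose r) * of_nat r ^ j :: rat))"
    proof (intro sum.cong refl)
      fix r
      have "(of_nat (Suc r) :: rat) ^ m' = (of_nat r + 1) ^ m'" by (simp add: add.commute)
      also have "\<dots> = (\<Sum>j\<le>m'. of_nat (m' choose j) * of_nat r ^ j)"
        by (subst binomial_ring) simp
      finally show "(-1) ^ r * of_nat (k' choose r) * of_nat (Suc r) ^ m' =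
          (\<Sum>j\<le>m'. of_nat (m' choose j) * ((-1) ^ r * of_nat (k' choose r) * of_nat r ^ j :: rat))"
        by (simp add: sum_distrib_left algebra_simps)
    qed
    also have "\<dots> = (\<Sum>j\<le>m'. of_nat (m' choose j) *
        (\<Sum>r\<le>k'. (-1) ^ r * of_nat (k' choose r) * of_nat r ^ j))"
      by (subst sum.swap) (simp add: sum_distrib_left)
    also have "\<dots> = 0"
      using less Suc k by (intro sum.neutral) auto
    finally show ?thesis
      unfolding k using alternating_binomial_sum_absorb[of k' "\<lambda>r. of_nat r ^ m'"] Suc by simp
  qed
qed

text \<open>The outer range may be enlarged at will, because the new inner sums vanish. This lets Bernoulli
  numbers of different index share one range.\<close>
lemma bernoulli_number_altdef:
  assumes "m \<le> M"
  shows "bernoulli_number m =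
     (\<Sum>k\<le>M. (\<Sum>r\<le>k. (-1) ^ r * of_nat (k choose r) * of_nat r ^ m) / of_nat (Suc k))"
  unfolding bernoulli_number_def lessThan_Suc_atMost
  using assms by (intro sum.mono_neutral_left) (auto simp: alternating_binomial_sum_power)

text \<open>Summing the defining formula over \<open>j\<close> with binomial weights replaces $r^j$ by
  $(r+1)^{m+1} - r^{m+1}$. Shifting and absorbing, which uses up the factor $1/(k+1)$, and summing over
  \<open>k\<close> first leaves the alternating sum of order \<open>m + 1\<close> of $r^m$ without its term at \<open>r = 0\<close>. The
  full sum is zero, so the result is that missing term, $0^m$.\<close>
lemma bernoulli_number_recurrence:
  "(\<Sum>j\<le>m. of_nat (Suc m choose j) * bernoulli_number j) = (if m = 0 then 1 else 0)"
proof -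
  have pow: "(\<Sum>j\<le>m. of_nat (Suc m choose j) * of_nat r ^ j) =
      (of_nat (Suc r) ^ Suc m - of_nat r ^ Suc m :: rat)" for r
  proof -
    have "(of_nat (Suc r) ^ Suc m :: rat) = (of_nat r + 1) ^ Suc m" by (simp add: add.commute)
    also have "\<dots> = (\<Sum>j\<le>Suc m. of_nat (Suc m choose j) * of_nat r ^ j)"
      by (subst binomial_ring) simp
    finally show ?thesis by simp
  qed
  have inner: "(\<Sum>r\<le>k. (-1) ^ r * of_nat (k choose r) * (of_nat (Suc r) ^ Suc m - of_nat r ^ Suc m)) /
      of_nat (Suc k) = (\<Sum>r\<le>k. (-1) ^ r * of_nat (k choose r) * of_nat (Suc r) ^ m :: rat)" for k
    using alternating_binomial_sum_shift[of k "\<lambda>r. of_nat r ^ Suc m"]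
      alternating_binomial_sum_absorb[of k "\<lambda>r. of_nat r ^ m"]
    by (simp add: field_simps del: of_nat_Suc binomial_Suc_Suc sum.atMost_Suc)
  have "(\<Sum>j\<le>m. of_nat (Suc m choose j) * bernoulli_number j) =
      (\<Sum>j\<le>m. \<Sum>k\<le>m. \<Sum>r\<le>k. (-1) ^ r * of_nat (k choose r) *
         (of_nat (Suc m choose j) * of_nat r ^ j) / of_nat (Suc k))"
    by (intro sum.cong refl, subst bernoulli_number_altdef[of _ m])
       (auto simp add: sum_distrib_left sum_divide_distrib algebra_simps simp del: of_nat_Suc binomial_Suc_Suc)
  also have "\<dots> = (\<Sum>k\<le>m. \<Sum>r\<le>k. \<Sum>j\<le>m. (-1) ^ r * of_nat (k choose r) *
         (of_nat (Suc m choose j) * of_nat r ^ j) / of_nat (Suc k))"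
    by (subst sum.swap, rule sum.cong[OF refl], rule sum.swap)
  also have "\<dots> = (\<Sum>k\<le>m. (\<Sum>r\<le>k. (-1) ^ r * of_nat (k choose r) *
      (of_nat (Suc r) ^ Suc m - of_nat r ^ Suc m)) / of_nat (Suc k))"
    by (simp only: pow [symmetric] sum_distrib_left sum_divide_distrib)
  also have "\<dots> = (\<Sum>k\<le>m. \<Sum>r\<le>k. (-1) ^ r * of_nat (k choose r) * of_nat (Suc r) ^ m)"
    by (simp only: inner)
  also have "\<dots> = (\<Sum>k\<le>m. \<Sum>r\<le>m. (-1) ^ r * of_nat (k choose r) * of_nat (Suc r) ^ m)"
    by (intro sum.cong refl sum.mono_neutral_left) (auto simp: binomial_eq_0)
  also have "\<dots> = (\<Sum>r\<le>m. (-1) ^ r * of_nat (Suc m choose Suc r) * of_nat (Suc r) ^ m)"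
    by (subst sum.swap) (simp only: sum_choose_upper of_nat_sum [symmetric]
        sum_distrib_left [symmetric] sum_distrib_right [symmetric])
  also have "\<dots> = (if m = 0 then 1 else 0) - (\<Sum>r\<le>Suc m. (-1) ^ r * of_nat (Suc m choose r) * of_nat r ^ m)"
    by (subst sum.atMost_Suc_shift[of _ m])
       (simp add: sum_negf power_0_left del: of_nat_Suc binomial_Suc_Suc sum.atMost_Suc)
  finally show ?thesis
    using alternating_binomial_sum_power[of m "Suc m"] by simp
qed

lemma bernoulli_number_values:
  "bernoulli_number 0 = 1" "bernoulli_number (Suc 0) = - 1 / 2" "bernoulli_number (Suc (Suc 0)) = 1 / 6"
  using bernoulli_number_recurrence[of 0] bernoulli_number_recurrence[of 1] bernoulli_number_recurrence[of 2]
  by (simp_all add: numeral_2_eq_2 binomial_eq_0)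

section \<open>Closure properties of recursive functions\<close>
lemma arg_Nil [simp]: "arg i [] = 0"
  by (simp add: arg_def)

lemma arg_Cons_0 [simp]: "arg 0 (x # xs) = x"
  by (simp add: arg_def)

lemma arg_Cons_Suc [simp]: "arg (Suc i) (x # xs) = arg i xs"
  by (simp add: arg_def)

lemma arg_drop [simp]: "arg i (drop d xs) = arg (i + d) xs"
  by (auto simp: arg_def add.commute)

lemma arg_tl [simp]: "arg i (tl xs) = arg (Suc i) xs"
  by (cases xs) auto

text \<open>Composition supplies a fixed finite list of arguments, whereas primitive recursion and the functions
  built below pass on an argument list of unknown length. What bridges the gap is that a recursive
  function looks at boundedly many arguments.\<close>
lemma recursive_function_finite_support:
  assumes "recursive_function f"
  shows "\<exists>m. \<forall>xs ys. (\<forall>i<m. arg i xs = arg i ys) \<longrightarrow> f xs = f ys"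
  using assms
proof (induction rule: recursive_function.induct)
  case zero
  show ?case by simp
next
  case successor
  show ?case by (rule exI[of _ 1]) auto
next
  case (projection i)
  show ?case by (rule exI[of _ "Suc i"]) auto
next
  case (composition f gs)
  then obtain m where m: "\<And>g xs ys. g \<in> set gs \<Longrightarrow> (\<forall>i<m g. arg i xs = arg i ys) \<Longrightarrow> g xs = g ys"
    by metis
  show ?case
  proof (intro exI[of _ "Max (insert 0 (m ` set gs))"] allI impI)
    fix xs ys :: "nat list"
    assume *: "\<forall>i<Max (insert 0 (m ` set gs)). arg i xs = arg i ys"
    have "g xs = g ys" if "g \<in> set gs" for g
    proof (rule m[OF that], intro allI impI)
      fix i assume "i < m g"
      also have "m g \<le> Max (insert 0 (m ` set gs))" using that by (intro Max_ge) auto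
      finally show "arg i xs = arg i ys" using * by blast
    qed
    then have "map (\<lambda>g. g xs) gs = map (\<lambda>g. g ys) gs" by auto
    then show "f (map (\<lambda>g. g xs) gs) = f (map (\<lambda>g. g ys) gs)" by (rule arg_cong[where f = f])
  qed
next
  case (primitive_recursion f h)
  then obtain m1 m2 where m1: "\<And>xs ys. (\<forall>i<m1. arg i xs = arg i ys) \<Longrightarrow> f xs = f ys"
    and m2: "\<And>xs ys. (\<forall>i<m2. arg i xs = arg i ys) \<Longrightarrow> h xs = h ys"
    by metis
  show ?case
  proof (intro exI[of _ "Suc (max m1 m2)"] allI impI)
    fix xs ys :: "nat list"
    assume *: "\<forall>i<Suc (max m1 m2). arg i xs = arg i ys"
    have f: "f (tl xs) = f (tl ys)" using * by (intro m1) auto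
    have h: "h (y # r # tl xs) = h (y # r # tl ys)" for y r
    proof (rule m2, intro allI impI)
      fix i assume "i < m2"
      then show "arg i (y # r # tl xs) = arg i (y # r # tl ys)"
      proof (cases i)
        case (Suc i')
        then show ?thesis using * \<open>i < m2\<close> by (cases i') auto
      qed simp
    qed
    show "rec_nat (f (tl xs)) (\<lambda>y r. h (y # r # tl xs)) (arg 0 xs) =
          rec_nat (f (tl ys)) (\<lambda>y r. h (y # r # tl ys)) (arg 0 ys)"
      using * by (simp add: f h)
  qed
next
  case (minimization f)
  then obtain m where m: "\<And>xs ys. (\<forall>i<m. arg i xs = arg i ys) \<Longrightarrow> f xs = f ys"
    by metis
  show ?case
  proof (intro exI[of _ m] allI impI)
    fix xs ys :: "nat list"
    assume *: "\<forall>i<m. arg i xs = arg i ys"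
    have "f (y # xs) = f (y # ys)" for y
    proof (rule m, intro allI impI)
      fix i assume "i < m"
      then show "arg i (y # xs) = arg i (y # ys)"
        using * by (cases i) auto
    qed
    then show "(LEAST y. f (y # xs) = 0) = (LEAST y. f (y # ys) = 0)" by simp
  qed
qed

text \<open>Substitution of an arbitrary transformation of the argument list. With it, argument lists act as
  environments in which a bound variable is consed to the front.\<close>
lemma recursive_function_subst:
  assumes "recursive_function f" "\<And>i. recursive_function (\<lambda>xs. arg i (\<sigma> xs))"
  shows "recursive_function (\<lambda>xs. f (\<sigma> xs))"
proof -
  obtain m where m: "\<And>xs ys. (\<forall>i<m. arg i xs = arg i ys) \<Longrightarrow> f xs = f ys"
    using recursive_function_finite_support[OF assms(1)] by metis
  have "recursive_function (\<lambda>xs. f (map (\<lambda>g. g xs) (map (\<lambda>i xs. arg i (\<sigma> xs)) [0..<m])))"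
    using assms by (intro recursive_function.composition) auto
  also have "(\<lambda>xs. f (map (\<lambda>g. g xs) (map (\<lambda>i xs. arg i (\<sigma> xs)) [0..<m]))) = (\<lambda>xs. f (\<sigma> xs))"
    by (intro ext m) (simp add: arg_def)
  finally show ?thesis .
qed

lemma recursive_function_Suc:
  assumes "recursive_function f"
  shows "recursive_function (\<lambda>xs. Suc (f xs))"
  using recursive_function.composition[OF recursive_function.successor, of "[f]"] assms by simp

lemma recursive_function_const: "recursive_function (\<lambda>_. c)"
  by (induction c) (auto intro: recursive_function.zero recursive_function_Suc)

lemma recursive_function_arg_Cons:
  assumes "recursive_function f" "\<And>i. recursive_function (\<lambda>xs. arg i (\<sigma> xs))"
  shows "recursive_function (\<lambda>xs. arg i (f xs # \<sigma> xs))"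
  using assms by (cases i) auto

lemma recursive_function_arg_drop: "recursive_function (\<lambda>xs. arg i (drop d xs))"
  by (simp add: recursive_function.projection)

lemma recursive_function_arg_tl: "recursive_function (\<lambda>xs. arg i (tl xs))"
  by (simp add: recursive_function.projection)

lemma recursive_function_arg_Nil: "recursive_function (\<lambda>xs. arg i [])"
  by (simp add: recursive_function.zero)

lemmas recursive_function_intros =
  recursive_function_Suc recursive_function_const recursive_function.projection
  recursive_function_arg_Cons recursive_function_arg_drop recursive_function_arg_tl
  recursive_function_arg_Nil

lemma recursive_function_drop:
  "recursive_function f \<Longrightarrow> recursive_function (\<lambda>xs. f (drop d xs))"
  by (erule recursive_function_subst) (intro recursive_function_intros)

lemma recursive_function_tl:
  "recursive_function f \<Longrightarrow> recursive_function (\<lambda>xs. f (tl xs))"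
  by (erule recursive_function_subst) (intro recursive_function_intros)

text \<open>Primitive recursion over a computed bound, where the step function sees the whole environment.\<close>
lemma recursive_function_rec_nat:
  assumes "recursive_function f" "recursive_function h" "recursive_function n"
  shows "recursive_function (\<lambda>xs. rec_nat (f xs) (\<lambda>y r. h (y # r # xs)) (n xs))"
proof -
  have "recursive_function (\<lambda>xs. arg i (n xs # xs))" for i
    using assms by (intro recursive_function_intros)
  from recursive_function_subst[OF recursive_function.primitive_recursion[OF assms(1,2)] this]
  show ?thesis by simp
qed

lemma recursive_function_add:
  assumes "recursive_function f" "recursive_function g"
  shows "recursive_function (\<lambda>xs. f xs + g xs)"
proof -
  have "recursive_function (\<lambda>xs. rec_nat (f xs) (\<lambda>y r. Suc (arg 1 (y # r # xs))) (g xs))"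
    using assms by (intro recursive_function_rec_nat recursive_function_intros)
  moreover have "rec_nat a (\<lambda>y r. Suc (arg 1 (y # r # xs))) b = a + b" for a b xs
    by (induction b) auto
  ultimately show ?thesis by simp
qed

lemma recursive_function_mult:
  assumes "recursive_function f" "recursive_function g"
  shows "recursive_function (\<lambda>xs. f xs * g xs)"
proof -
  have "recursive_function (\<lambda>xs. rec_nat 0
      (\<lambda>y r. arg 1 (y # r # xs) + f (drop 2 (y # r # xs))) (g xs))"
    using assms
    by (intro recursive_function_rec_nat recursive_function_intros recursive_function_add
        recursive_function_drop)
  moreover have "rec_nat 0 (\<lambda>y r. arg 1 (y # r # xs) + f (drop 2 (y # r # xs))) b = f xs * b" for b xs
    by (induction b) auto
  ultimately show ?thesis by simp
qed

lemma recursive_function_diff: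
  assumes "recursive_function f" "recursive_function g"
  shows "recursive_function (\<lambda>xs. f xs - g xs)"
proof -
  have "recursive_function (\<lambda>xs. rec_nat 0 (\<lambda>y r. arg 0 (y # r # xs)) (arg 0 xs))"
    by (intro recursive_function_rec_nat recursive_function_intros)
  moreover have "rec_nat 0 (\<lambda>y r. arg 0 (y # r # xs)) b = b - 1" for b xs
    by (cases b) auto
  ultimately have pred: "recursive_function (\<lambda>xs. arg 0 xs - 1)" by simp
  have "recursive_function (\<lambda>xs. arg 0 [arg 1 xs] - 1)"
    by (rule recursive_function_subst[OF pred]) (intro recursive_function_intros)
  then have "recursive_function (\<lambda>xs. arg 1 xs - 1)" by simp
  then have "recursive_function (\<lambda>xs. rec_nat (f xs) (\<lambda>y r. arg 1 (y # r # xs) - 1) (g xs))"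
    using assms by (intro recursive_function_rec_nat)
  moreover have "rec_nat a (\<lambda>y r. arg 1 (y # r # xs) - 1) b = a - b" for a b xs
    by (induction b) auto
  ultimately show ?thesis by simp
qed

lemma recursive_function_sum:
  assumes "recursive_function f" "recursive_function n"
  shows "recursive_function (\<lambda>xs. \<Sum>k<n xs. f (k # xs))"
proof -
  have "recursive_function (\<lambda>xs. f (arg 0 xs # drop 2 xs))"
    by (rule recursive_function_subst[OF assms(1)]) (intro recursive_function_intros)
  then have "recursive_function (\<lambda>xs. rec_nat 0 (\<lambda>y r. arg 1 (y # r # xs) +
      f (arg 0 (y # r # xs) # drop 2 (y # r # xs))) (n xs))"
    using assms by (intro recursive_function_rec_nat recursive_function_intros recursive_function_add)
  moreover have "rec_nat 0 (\<lambda>y r. arg 1 (y # r # xs) +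
      f (arg 0 (y # r # xs) # drop 2 (y # r # xs))) b = (\<Sum>k<b. f (k # xs))" for b xs
    by (induction b) auto
  ultimately show ?thesis by simp
qed

lemma recursive_function_prod:
  assumes "recursive_function f" "recursive_function n"
  shows "recursive_function (\<lambda>xs. \<Prod>k<n xs. f (k # xs))"
proof -
  have "recursive_function (\<lambda>xs. f (arg 0 xs # drop 2 xs))"
    by (rule recursive_function_subst[OF assms(1)]) (intro recursive_function_intros)
  then have "recursive_function (\<lambda>xs. rec_nat 1 (\<lambda>y r. arg 1 (y # r # xs) *
      f (arg 0 (y # r # xs) # drop 2 (y # r # xs))) (n xs))"
    using assms by (intro recursive_function_rec_nat recursive_function_intros recursive_function_mult)
  moreover have "rec_nat 1 (\<lambda>y r. arg 1 (y # r # xs) *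
      f (arg 0 (y # r # xs) # drop 2 (y # r # xs))) b = (\<Prod>k<b. f (k # xs))" for b xs
    by (induction b) (auto simp: mult.commute)
  ultimately show ?thesis by simp
qed

lemma recursive_function_fact:
  assumes "recursive_function n"
  shows "recursive_function (\<lambda>xs. fact (n xs))"
proof -
  have "recursive_function (\<lambda>xs. \<Prod>k<n xs. Suc (arg 0 (k # xs)))"
    using assms by (intro recursive_function_prod recursive_function_intros)
  moreover have "(\<Prod>k<b. Suc k) = fact b" for b
    by (induction b) auto
  ultimately show ?thesis by simp
qed

lemma recursive_function_power:
  assumes "recursive_function f" "recursive_function n"
  shows "recursive_function (\<lambda>xs. f xs ^ n xs)"
proof -
  have "recursive_function (\<lambda>xs. \<Prod>k<n xs. f (tl (k # xs)))"
    using assms by (intro recursive_function_prod recursive_function_tl)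
  then show ?thesis by simp
qed

lemma recursive_function_if_eq:
  assumes "recursive_function f" "recursive_function g" "recursive_function h" "recursive_function l"
  shows "recursive_function (\<lambda>xs. if f xs = g xs then h xs else l xs)"
proof -
  have "recursive_function (\<lambda>xs. (1 - ((f xs - g xs) + (g xs - f xs))) * h xs +
      (1 - (1 - ((f xs - g xs) + (g xs - f xs)))) * l xs)"
    using assms by (intro recursive_function_add recursive_function_mult recursive_function_diff
        recursive_function_const)
  also have "(\<lambda>xs. (1 - ((f xs - g xs) + (g xs - f xs))) * h xs +
      (1 - (1 - ((f xs - g xs) + (g xs - f xs)))) * l xs) =
      (\<lambda>xs. if f xs = g xs then h xs else l xs)"
  proof
    fix xs
    show "(1 - ((f xs - g xs) + (g xs - f xs))) * h xs +
      (1 - (1 - ((f xs - g xs) + (g xs - f xs)))) * l xs = (if f xs = g xs then h xs else l xs)"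
    proof (cases "f xs = g xs")
      case False
      then have "(f xs - g xs) + (g xs - f xs) > 0" by arith
      then have "1 - ((f xs - g xs) + (g xs - f xs)) = 0" by arith
      then show ?thesis using False by simp
    qed simp
  qed
  finally show ?thesis .
qed

section \<open>Rational-valued recursive functions\<close>

text \<open>Matches \<open>computable_rat_seq\<close>, but over argument lists, so that the summand of a finite sum is again
  such a function, of the summation index and the remaining arguments.\<close>
definition recursive_rat_function :: "(nat list \<Rightarrow> rat) \<Rightarrow> bool" where
  "recursive_rat_function q \<longleftrightarrow>
     (\<exists>a b c. recursive_function a \<and> recursive_function b \<and> recursive_function c \<and>
        (\<forall>xs. c xs > 0 \<and> q xs = (of_nat (a xs) - of_nat (b xs)) / of_nat (c xs)))"

lemma recursive_rat_functionI:
  assumes "recursive_function a" "recursive_function b" "recursive_function c"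
    and "\<And>xs. c xs > 0" "\<And>xs. q xs = (of_nat (a xs) - of_nat (b xs)) / of_nat (c xs)"
  shows "recursive_rat_function q"
  using assms unfolding recursive_rat_function_def by blast

lemma recursive_rat_functionE:
  assumes "recursive_rat_function q"
  obtains a b c where "recursive_function a" "recursive_function b" "recursive_function c"
    "\<And>xs. c xs > 0" "\<And>xs. q xs = (of_nat (a xs) - of_nat (b xs)) / of_nat (c xs)"
  using assms unfolding recursive_rat_function_def by blast

lemma computable_rat_seqI:
  assumes "recursive_rat_function (\<lambda>xs. g (arg 0 xs))"
  shows "computable_rat_seq g"
proof -
  from assms obtain a b c where abc: "recursive_function a" "recursive_function b" "recursive_function c"
    and eq: "\<And>xs. c xs > 0" "\<And>xs. g (arg 0 xs) = (of_nat (a xs) - of_nat (b xs)) / of_nat (c xs)"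
    by (rule recursive_rat_functionE) blast
  have "computable_nat_seq (\<lambda>j. f [j])" if "recursive_function f" for f
    unfolding computable_nat_seq_def
    by (rule recursive_function_subst[OF that]) (intro recursive_function_intros)
  then show ?thesis
    unfolding computable_rat_seq_def using abc eq(1) eq(2)[of "[_]"]
    by (intro exI[of _ "\<lambda>j. a [j]"] exI[of _ "\<lambda>j. b [j]"] exI[of _ "\<lambda>j. c [j]"]) auto
qed

lemma recursive_rat_function_subst:
  assumes "recursive_rat_function q" "\<And>i. recursive_function (\<lambda>xs. arg i (\<sigma> xs))"
  shows "recursive_rat_function (\<lambda>xs. q (\<sigma> xs))"
  using assms(1)
proof (rule recursive_rat_functionE)
  fix a b c
  assume "recursive_function a" "recursive_function b" "recursive_function c"
    "\<And>xs. c xs > 0" "\<And>xs. q xs = (of_nat (a xs) - of_nat (b xs)) / of_nat (c xs)"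
  then show ?thesis
    by (intro recursive_rat_functionI[of "\<lambda>xs. a (\<sigma> xs)" "\<lambda>xs. b (\<sigma> xs)" "\<lambda>xs. c (\<sigma> xs)"]
        recursive_function_subst[OF _ assms(2)])
qed

lemma recursive_rat_function_of_nat:
  assumes "recursive_function f"
  shows "recursive_rat_function (\<lambda>xs. of_nat (f xs))"
  by (rule recursive_rat_functionI[of f "\<lambda>_. 0" "\<lambda>_. 1"]) (auto intro: assms recursive_function_const)

lemma recursive_rat_function_diff:
  assumes "recursive_rat_function p" "recursive_rat_function q"
  shows "recursive_rat_function (\<lambda>xs. p xs - q xs)"
proof -
  obtain a b c where 1: "recursive_function a" "recursive_function b" "recursive_function c"
    "\<And>xs. c xs > 0" "\<And>xs. p xs = (of_nat (a xs) - of_nat (b xs)) / of_nat (c xs)"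
    using assms(1) by (rule recursive_rat_functionE) blast
  obtain a' b' c' where 2: "recursive_function a'" "recursive_function b'" "recursive_function c'"
    "\<And>xs. c' xs > 0" "\<And>xs. q xs = (of_nat (a' xs) - of_nat (b' xs)) / of_nat (c' xs)"
    using assms(2) by (rule recursive_rat_functionE) blast
  show ?thesis
  proof (rule recursive_rat_functionI[of "\<lambda>xs. a xs * c' xs + b' xs * c xs"
        "\<lambda>xs. b xs * c' xs + a' xs * c xs" "\<lambda>xs. c xs * c' xs"])
    fix xs
    show "p xs - q xs = (of_nat (a xs * c' xs + b' xs * c xs) - of_nat (b xs * c' xs + a' xs * c xs)) /
        of_nat (c xs * c' xs)"
      using 1(4)[of xs] 2(4)[of xs] by (simp add: 1(5) 2(5) field_simps)
  qed (use 1 2 in \<open>auto intro!: recursive_function_add recursive_function_mult\<close>)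
qed

lemma recursive_rat_function_mult:
  assumes "recursive_rat_function p" "recursive_rat_function q"
  shows "recursive_rat_function (\<lambda>xs. p xs * q xs)"
proof -
  obtain a b c where 1: "recursive_function a" "recursive_function b" "recursive_function c"
    "\<And>xs. c xs > 0" "\<And>xs. p xs = (of_nat (a xs) - of_nat (b xs)) / of_nat (c xs)"
    using assms(1) by (rule recursive_rat_functionE) blast
  obtain a' b' c' where 2: "recursive_function a'" "recursive_function b'" "recursive_function c'"
    "\<And>xs. c' xs > 0" "\<And>xs. q xs = (of_nat (a' xs) - of_nat (b' xs)) / of_nat (c' xs)"
    using assms(2) by (rule recursive_rat_functionE) blast
  show ?thesis
  proof (rule recursive_rat_functionI[of "\<lambda>xs. a xs * a' xs + b xs * b' xs"
        "\<lambda>xs. a xs * b' xs + b xs * a' xs" "\<lambda>xs. c xs * c' xs"])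
    fix xs
    show "p xs * q xs = (of_nat (a xs * a' xs + b xs * b' xs) - of_nat (a xs * b' xs + b xs * a' xs)) /
        of_nat (c xs * c' xs)"
      by (simp add: 1(5) 2(5) algebra_simps)
  qed (use 1 2 in \<open>auto intro!: recursive_function_add recursive_function_mult\<close>)
qed

text \<open>Division by zero yields zero, and the representation has to follow this convention with a positive
  denominator; hence the two case distinctions.\<close>
lemma recursive_rat_function_divide_nat:
  assumes "recursive_rat_function p" "recursive_function f"
  shows "recursive_rat_function (\<lambda>xs. p xs / of_nat (f xs))"
proof -
  have "recursive_rat_function (\<lambda>xs. 1 / of_nat (f xs))"
  proof (rule recursive_rat_functionI[of "\<lambda>xs. if f xs = 0 then 0 else 1" "\<lambda>xs. 0"
        "\<lambda>xs. if f xs = 0 then 1 else f xs"])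
    show "recursive_function (\<lambda>xs. if f xs = 0 then 0 else 1)"
      "recursive_function (\<lambda>xs. if f xs = 0 then 1 else f xs)"
      by (rule recursive_function_if_eq assms(2) recursive_function_const)+
  qed (auto intro: recursive_function_const)
  from recursive_rat_function_mult[OF assms(1) this] show ?thesis by simp
qed

text \<open>All summands are brought to the product of all denominators as common denominator. The cofactor of
  the \<open>k\<close>-th denominator is computed as a product in which the \<open>k\<close>-th factor is replaced by 1, which
  avoids recursion on pairs of numbers.\<close>
lemma recursive_rat_function_sum:
  assumes "recursive_rat_function q" "recursive_function n"
  shows "recursive_rat_function (\<lambda>xs. \<Sum>k<n xs. q (k # xs))"
proof -
  obtain a b c where 1: "recursive_function a" "recursive_function b" "recursive_function c"
    "\<And>xs. c xs > 0" "\<And>xs. q xs = (of_nat (a xs) - of_nat (b xs)) / of_nat (c xs)"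
    using assms(1) by (rule recursive_rat_functionE) blast
  define cofactor where "cofactor = (\<lambda>ys. \<Prod>i<n (tl ys).
    if arg 0 (i # ys) = arg 1 (i # ys) then 1 else c (arg 0 (i # ys) # drop 2 (i # ys)))"
  have "recursive_function (\<lambda>zs. c (arg 0 zs # drop 2 zs))"
    by (rule recursive_function_subst[OF 1(3)]) (intro recursive_function_intros)
  then have cof: "recursive_function cofactor"
    unfolding cofactor_def
    by (intro recursive_function_prod[where f = "\<lambda>zs. if arg 0 zs = arg 1 zs then 1 else c (arg 0 zs # drop 2 zs)"]
        recursive_function_if_eq recursive_function_intros recursive_function_tl assms(2))
  have cof_eq: "cofactor (k # xs) * c (k # xs) = (\<Prod>i<n xs. c (i # xs))" if "k < n xs" for k xs
  proof -
    have "cofactor (k # xs) = (\<Prod>i\<in>{..<n xs} - {k}. c (i # xs))"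
      using that unfolding cofactor_def by (subst prod.remove[of _ k]) (auto intro!: prod.cong)
    then show ?thesis using that by (subst prod.remove[of _ k]) (auto simp: mult.commute)
  qed
  show ?thesis
  proof (rule recursive_rat_functionI[of "\<lambda>xs. \<Sum>k<n xs. a (k # xs) * cofactor (k # xs)"
        "\<lambda>xs. \<Sum>k<n xs. b (k # xs) * cofactor (k # xs)" "\<lambda>xs. \<Prod>i<n xs. c (i # xs)"])
    fix xs
    show pos: "0 < (\<Prod>i<n xs. c (i # xs))" using 1(4) by (intro prod_pos) auto
    have "q (k # xs) = (of_nat (a (k # xs) * cofactor (k # xs)) - of_nat (b (k # xs) * cofactor (k # xs))) /
        of_nat (\<Prod>i<n xs. c (i # xs))" if "k < n xs" for k
    proof -
      have "cofactor (k # xs) \<noteq> 0" using cof_eq[OF that] pos by (metis less_irrefl mult_zero_left)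
      then show ?thesis unfolding 1(5) cof_eq[OF that, symmetric] using 1(4)[of "k # xs"]
        by (simp add: field_simps)
    qed
    then show "(\<Sum>k<n xs. q (k # xs)) = (of_nat (\<Sum>k<n xs. a (k # xs) * cofactor (k # xs)) -
        of_nat (\<Sum>k<n xs. b (k # xs) * cofactor (k # xs))) / of_nat (\<Prod>i<n xs. c (i # xs))"
      by (simp add: sum_subtractf [symmetric] sum_divide_distrib del: of_nat_mult of_nat_prod)
  qed (use 1 cof assms(2) in \<open>auto intro!: recursive_function_mult recursive_function_sum[where f = "\<lambda>ys. _ ys * cofactor ys"]
      recursive_function_prod\<close>)
qed

text \<open>$(-1)^n = 1 - 2 [n \text{ odd}]$, and parity flips under $r \mapsto 1 - r$.\<close>
lemma recursive_rat_function_minus_one_power: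
  assumes "recursive_function n"
  shows "recursive_rat_function (\<lambda>xs. (- 1) ^ n xs)"
proof -
  have "recursive_function (\<lambda>xs. rec_nat 0 (\<lambda>y r. 1 - arg 1 (y # r # xs)) (n xs))"
    using assms by (intro recursive_function_rec_nat recursive_function_diff recursive_function_intros)
  moreover have "rec_nat 0 (\<lambda>y r. 1 - arg 1 (y # r # xs)) b = of_bool (odd b)" for b xs
    by (induction b) auto
  ultimately have "recursive_function (\<lambda>xs. of_bool (odd (n xs)))" by simp
  then show ?thesis
    by (intro recursive_rat_functionI[of "\<lambda>_. 1" "\<lambda>xs. 2 * of_bool (odd (n xs))" "\<lambda>_. 1"]
        recursive_function_mult recursive_function_const) auto
qed

text \<open>In the inner summand the environment is \<open>r # k # m # \<dots>\<close>. Binomial coefficients are quotients of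
  factorials there, as \<open>r \<le> k\<close> throughout.\<close>
lemma recursive_rat_function_bernoulli_number:
  assumes "recursive_function f"
  shows "recursive_rat_function (\<lambda>xs. bernoulli_number (f xs))"
proof -
  have "recursive_rat_function (\<lambda>xs. \<Sum>k<Suc (arg 0 xs).
      (\<Sum>r<Suc (arg 0 (k # xs)). (- 1) ^ arg 0 (r # k # xs) *
         (of_nat (fact (arg 1 (r # k # xs))) /
          of_nat (fact (arg 0 (r # k # xs)) * fact (arg 1 (r # k # xs) - arg 0 (r # k # xs)))) *
         of_nat (arg 0 (r # k # xs) ^ arg 2 (r # k # xs))) / of_nat (Suc (arg 0 (k # xs))))"
    by (intro recursive_rat_function_sum[where q = "\<lambda>ys. (\<Sum>r<Suc (arg 0 ys). _ (r # ys)) / _ ys"]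
        recursive_rat_function_divide_nat
        recursive_rat_function_sum[where q = "\<lambda>zs. (- 1) ^ arg 0 zs * _ zs * _ zs"]
        recursive_rat_function_mult recursive_rat_function_minus_one_power recursive_rat_function_of_nat
        recursive_function_fact recursive_function_mult recursive_function_power
        recursive_function_diff recursive_function_intros)
  also have "(\<lambda>xs. \<Sum>k<Suc (arg 0 xs).
      (\<Sum>r<Suc (arg 0 (k # xs)). (- 1) ^ arg 0 (r # k # xs) *
         (of_nat (fact (arg 1 (r # k # xs))) /
          of_nat (fact (arg 0 (r # k # xs)) * fact (arg 1 (r # k # xs) - arg 0 (r # k # xs)))) *
         of_nat (arg 0 (r # k # xs) ^ arg 2 (r # k # xs))) / of_nat (Suc (arg 0 (k # xs)))) =
      (\<lambda>xs. bernoulli_number (arg 0 xs))"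
    unfolding bernoulli_number_def
    by (intro ext sum.cong arg_cong2[where f = "(/)"] refl)
       (simp_all add: binomial_fact numeral_2_eq_2)
  finally have "recursive_rat_function (\<lambda>xs. bernoulli_number (arg 0 xs))" .
  from recursive_rat_function_subst[OF this, of "\<lambda>xs. [f xs]"] show ?thesis
    using assms by (simp add: recursive_function_intros)
qed

section \<open>One step of the Euler-Maclaurin approximation\<close>
lemma norm_gbinomial_le:
  fixes a :: complex
  assumes "norm a \<le> A"
  shows "norm (a gchoose k) \<le> pochhammer A k / fact k"
proof -
  have "norm (pochhammer (- a) k) \<le> pochhammer A k"
    unfolding pochhammer_prod prod_norm [symmetric]
  proof (intro prod_mono conjI norm_ge_zero)
    fix i
    have "norm (- a + of_nat i) \<le> norm (- a) + norm (of_nat i :: complex)" by (rule norm_triangle_ineq)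
    then show "norm (- a + of_nat i) \<le> A + real i" using assms by simp
  qed
  then show ?thesis
    by (simp add: gbinomial_pochhammer norm_mult norm_divide norm_power divide_right_mono)
qed

text \<open>A remainder estimate with a constant that depends on \<open>a\<close> through a bound on its norm only, as
  needed for uniformity in \<open>s\<close>. The series is dominated by that of $(1-x)^{-A}$. Beyond order \<open>M\<close> each
  term at \<open>x\<close> is at most $(2x)^{M+1}$ times the term at $\frac12$, and the dominating series at
  $\frac12$ has the value $2^A$.\<close>
lemma binomial_series_remainder:
  fixes a :: complex and x :: real
  assumes "norm a \<le> A" "0 \<le> x" "x \<le> 1 / 2"
  shows "norm ((1 + of_real x) powr a - (\<Sum>k\<le>M. (a gchoose k) * of_real x ^ k)) \<le>
           2 powr A * (2 * x) ^ Suc M"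
proof -
  define p where "p k = pochhammer A k / fact k" for k
  have A: "A \<ge> 0" using assms(1) norm_ge_zero[of a] by linarith
  have p_nonneg: "p k \<ge> 0" for k
    unfolding p_def pochhammer_prod using A by (intro divide_nonneg_pos prod_nonneg) auto
  have "(\<lambda>k. ((- A) gchoose k) * (- (1 / 2)) ^ k) sums (1 + - (1 / 2)) powr (- A)"
    by (rule gen_binomial_real) simp
  also have "(\<lambda>k. ((- A) gchoose k) * (- (1 / 2)) ^ k) = (\<lambda>k. p k * (1 / 2) ^ k)"
  proof
    fix k
    have "(- (1 / 2) :: real) ^ k = (- 1) ^ k * (1 / 2) ^ k" by (rule power_minus)
    then show "((- A) gchoose k) * (- (1 / 2)) ^ k = p k * (1 / 2) ^ k"
      by (simp add: gbinomial_pochhammer p_def)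
  qed
  also have "(1 + - (1 / 2)) powr (- A) = (2 powr A :: real)"
    by (simp add: powr_minus_divide powr_divide)
  finally have p_sums: "(\<lambda>k. p k * (1 / 2) ^ k) sums 2 powr A" .
  have "(\<lambda>k. (a gchoose (k + Suc M)) * of_real x ^ (k + Suc M)) sums
      ((1 + of_real x) powr a - (\<Sum>k<Suc M. (a gchoose k) * of_real x ^ k))"
    using assms by (intro sums_split_initial_segment gen_binomial_complex) auto
  moreover have "(\<lambda>k. p (k + Suc M) * (1 / 2) ^ (k + Suc M) * (2 * x) ^ Suc M) sums
      ((2 powr A - (\<Sum>k<Suc M. p k * (1 / 2) ^ k)) * (2 * x) ^ Suc M)"
    by (intro sums_mult2 sums_split_initial_segment p_sums)
  moreover have "norm ((a gchoose (k + Suc M)) * of_real x ^ (k + Suc M)) \<le>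
      p (k + Suc M) * (1 / 2) ^ (k + Suc M) * (2 * x) ^ Suc M" for k
  proof -
    have "norm ((a gchoose (k + Suc M)) * of_real x ^ (k + Suc M)) =
        norm (a gchoose (k + Suc M)) * x ^ (k + Suc M)"
      using assms by (simp add: norm_mult norm_power)
    also have "\<dots> \<le> p (k + Suc M) * x ^ (k + Suc M)"
      unfolding p_def using assms by (intro mult_right_mono norm_gbinomial_le) auto
    also have "x ^ (k + Suc M) = (1 / 2) ^ (k + Suc M) * (2 * x) ^ (k + Suc M)"
      by (simp only: power_mult_distrib [symmetric]) simp
    also have "\<dots> \<le> (1 / 2) ^ (k + Suc M) * (2 * x) ^ Suc M"
      using assms by (intro mult_left_mono power_decreasing) auto
    finally show ?thesis using p_nonneg[of "k + Suc M"] by (simp add: mult_left_mono mult.assoc)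
  qed
  ultimately have "norm ((1 + of_real x) powr a - (\<Sum>k<Suc M. (a gchoose k) * of_real x ^ k)) \<le>
      (2 powr A - (\<Sum>k<Suc M. p k * (1 / 2) ^ k)) * (2 * x) ^ Suc M"
    by (rule norm_sums_le)
  also have "\<dots> \<le> 2 powr A * (2 * x) ^ Suc M"
    using assms p_nonneg by (intro mult_right_mono) (auto intro!: sum_nonneg simp del: sum.lessThan_Suc)
  finally show ?thesis by (simp only: lessThan_Suc_atMost)
qed

text \<open>The classical coefficient $\frac{B_j}{j!} (-s)(-s-1)\cdots(2-s-j)$, in a form that makes the
  recurrence below a consequence of the trinomial revision of binomial coefficients.\<close>
definition euler_maclaurin_coeff :: "nat \<Rightarrow> complex \<Rightarrow> complex" where
  "euler_maclaurin_coeff j s = of_rat (bernoulli_number j) * ((1 - s) gchoose j) / (1 - s)"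

definition euler_maclaurin_sum :: "nat \<Rightarrow> nat \<Rightarrow> complex \<Rightarrow> complex" where
  "euler_maclaurin_sum N n s =
     (\<Sum>j\<le>N. euler_maclaurin_coeff j s * of_nat n powr (1 - s - of_nat j))"

definition zeta_approx :: "nat \<Rightarrow> nat \<Rightarrow> complex \<Rightarrow> complex" where
  "zeta_approx N n s = (\<Sum>k = 1..<n. of_nat k powr (- s)) - euler_maclaurin_sum N n s"

text \<open>By trinomial revision the summand is ${1-s \choose m+1} {m+1 \choose j} B_j / (1-s)$, so only the
  Bernoulli recurrence remains.\<close>
lemma euler_maclaurin_coeff_recurrence:
  assumes "s \<noteq> 1"
  shows "(\<Sum>j\<le>m. euler_maclaurin_coeff j s * ((1 - s - of_nat j) gchoose Suc (m - j))) =
         (if m = 0 then 1 else 0)"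
proof -
  have "(\<Sum>j\<le>m. euler_maclaurin_coeff j s * ((1 - s - of_nat j) gchoose Suc (m - j))) =
      (\<Sum>j\<le>m. ((1 - s) gchoose Suc m) / (1 - s) * of_rat (of_nat (Suc m choose j) * bernoulli_number j))"
  proof (intro sum.cong refl)
    fix j assume "j \<in> {..m}"
    then have j: "j \<le> Suc m" "Suc m - j = Suc (m - j)" by auto
    have "((1 - s) gchoose j) * ((1 - s - of_nat j) gchoose Suc (m - j)) =
        ((1 - s) gchoose Suc m) * of_nat (Suc m choose j)"
      using gbinomial_trinomial_revision[OF j(1), of "1 - s"] unfolding j(2) binomial_gbinomial by metis
    then show "euler_maclaurin_coeff j s * ((1 - s - of_nat j) gchoose Suc (m - j)) =
        ((1 - s) gchoose Suc m) / (1 - s) * of_rat (of_nat (Suc m choose j) * bernoulli_number j)"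
      by (simp add: euler_maclaurin_coeff_def of_rat_mult del: binomial_Suc_Suc)
  qed
  also have "\<dots> = ((1 - s) gchoose Suc m) / (1 - s) *
      of_rat (\<Sum>j\<le>m. of_nat (Suc m choose j) * bernoulli_number j)"
    by (simp only: of_rat_sum sum_distrib_left)
  also have "\<dots> = (if m = 0 then 1 else 0)"
    using assms by (simp only: bernoulli_number_recurrence) auto
  finally show ?thesis .
qed

text \<open>The coefficients are chosen so that, when every $(1+1/n)^{1-s-j}$ is cut off at total order \<open>N + 1\<close>,
  the increment of the sum is exactly $n^{-s}$. Hence the deviation of the increment from $n^{-s}$
  consists of binomial remainders.\<close>
lemma euler_maclaurin_sum_step:
  assumes "s \<noteq> 1" "n \<ge> 1"
  shows "euler_maclaurin_sum N (Suc n) s - euler_maclaurin_sum N n s - of_nat n powr (- s) =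
    (\<Sum>j\<le>N. euler_maclaurin_coeff j s * of_nat n powr (1 - s - of_nat j) *
       ((1 + of_real (1 / n)) powr (1 - s - of_nat j) -
        (\<Sum>k\<le>Suc N - j. ((1 - s - of_nat j) gchoose k) * of_real (1 / n) ^ k)))"
proof -
  define c where "c = euler_maclaurin_coeff"
  define a where "a j = 1 - s - of_nat j" for j
  have pow_add: "of_nat n powr (w - of_nat k) = of_nat n powr w * of_real (1 / n) ^ k" for w :: complex and k
    using assms by (simp add: powr_diff powr_nat power_divide)
  have shift: "of_nat (Suc n) powr w = of_nat n powr w * (1 + of_real (1 / n)) powr w" for w :: complex
  proof -
    have "of_nat (Suc n) = of_nat n * (1 + of_real (1 / n) :: complex)"
      using assms by (simp add: field_simps)
    also have "\<dots> powr w = of_nat n powr w * (1 + of_real (1 / n)) powr w"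
      by (intro powr_times_real) auto
    finally show ?thesis .
  qed
  have "(\<Sum>j\<le>N. c j s * of_nat n powr a j * (\<Sum>k\<le>Suc N - j. (a j gchoose k) * of_real (1 / n) ^ k)) =
      (\<Sum>j\<le>N. c j s * of_nat n powr a j +
        (\<Sum>k\<le>N - j. c j s * (a j gchoose Suc k) * of_nat n powr (- s - of_nat (j + k))))"
  proof (intro sum.cong refl)
    fix j assume "j \<in> {..N}"
    then have j: "Suc N - j = Suc (N - j)" by auto
    have "c j s * of_nat n powr a j * ((a j gchoose Suc k) * of_real (1 / n) ^ Suc k) =
        c j s * (a j gchoose Suc k) * of_nat n powr (- s - of_nat (j + k))" for k
    proof -
      have "- s - of_nat (j + k) = a j - of_nat (Suc k)" by (simp add: a_def)
      then show ?thesis by (simp only: pow_add mult_ac)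
    qed
    then show "c j s * of_nat n powr a j * (\<Sum>k\<le>Suc N - j. (a j gchoose k) * of_real (1 / n) ^ k) =
        c j s * of_nat n powr a j +
        (\<Sum>k\<le>N - j. c j s * (a j gchoose Suc k) * of_nat n powr (- s - of_nat (j + k)))"
      unfolding j by (subst sum.atMost_Suc_shift) (simp add: distrib_left sum_distrib_left)
  qed
  also have "\<dots> = euler_maclaurin_sum N n s +
      (\<Sum>j\<le>N. \<Sum>k\<le>N - j. c j s * (a j gchoose Suc k) * of_nat n powr (- s - of_nat (j + k)))"
    by (simp add: sum.distrib euler_maclaurin_sum_def c_def a_def)
  also have "(\<Sum>j\<le>N. \<Sum>k\<le>N - j. c j s * (a j gchoose Suc k) * of_nat n powr (- s - of_nat (j + k))) =
      (\<Sum>(j, k)\<in>{(j, k). j + k \<le> N}. c j s * (a j gchoose Suc k) * of_nat n powr (- s - of_nat (j + k)))"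
    by (subst sum.Sigma) (auto intro!: sum.cong)
  also have "\<dots> = (\<Sum>m\<le>N. \<Sum>j\<le>m. c j s * (a j gchoose Suc (m - j)) * of_nat n powr (- s - of_nat (j + (m - j))))"
    by (rule sum.triangle_reindex_eq)
  also have "\<dots> = (\<Sum>m\<le>N. (\<Sum>j\<le>m. c j s * (a j gchoose Suc (m - j))) * of_nat n powr (- s - of_nat m))"
    by (simp add: sum_distrib_right)
  also have "\<dots> = (\<Sum>m\<le>N. if m = 0 then of_nat n powr (- s) else 0)"
    unfolding c_def a_def using assms(1) by (intro sum.cong refl, subst euler_maclaurin_coeff_recurrence) auto
  also have "\<dots> = of_nat n powr (- s)" by simp
  finally have *: "(\<Sum>j\<le>N. c j s * of_nat n powr a j *
      (\<Sum>k\<le>Suc N - j. (a j gchoose k) * of_real (1 / n) ^ k)) = euler_maclaurin_sum N n s + of_nat n powr (- s)" .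
  have "euler_maclaurin_sum N (Suc n) s = (\<Sum>j\<le>N. c j s * of_nat n powr a j * (1 + of_real (1 / n)) powr a j)"
    unfolding euler_maclaurin_sum_def shift by (simp only: c_def a_def mult.assoc)
  then show ?thesis
    unfolding right_diff_distrib sum_subtractf
    using * unfolding c_def a_def by (simp only: algebra_simps)
qed

lemma euler_maclaurin_coeff_holomorphic: "euler_maclaurin_coeff j holomorphic_on - {1}"
proof -
  have "(\<lambda>s. (1 - s) gchoose j) holomorphic_on - {1 :: complex}"
    by (intro analytic_imp_holomorphic analytic_intros)
  then show ?thesis
    unfolding euler_maclaurin_coeff_def by (intro holomorphic_intros) auto
qed

lemma zeta_approx_holomorphic: "zeta_approx N n holomorphic_on - {1}"
  unfolding zeta_approx_def euler_maclaurin_sum_def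
  by (intro holomorphic_on_diff holomorphic_on_sum holomorphic_on_mult
      euler_maclaurin_coeff_holomorphic holomorphic_on_powr_right holomorphic_on_minus
      holomorphic_on_ident holomorphic_on_const)

lemma zeta_approx_step_bound:
  assumes "compact K" "1 \<notin> K"
  shows "\<exists>C\<ge>0. \<forall>n\<ge>2. \<forall>s\<in>K. norm (zeta_approx N (Suc n) s - zeta_approx N n s) \<le>
           C * real n powr (- Re s - real N - 1)"
proof -
  have "\<exists>C\<ge>0. \<forall>n\<ge>2. \<forall>s\<in>K. norm (euler_maclaurin_coeff j s * of_nat n powr (1 - s - of_nat j) *
       ((1 + of_real (1 / n)) powr (1 - s - of_nat j) -
        (\<Sum>k\<le>Suc N - j. ((1 - s - of_nat j) gchoose k) * of_real (1 / n) ^ k))) \<le>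
        C * real n powr (- Re s - real N - 1)" if j: "j \<le> N" for j
  proof -
    have "continuous_on K (euler_maclaurin_coeff j)"
      using assms(2)
      by (intro holomorphic_on_imp_continuous_on
          holomorphic_on_subset[OF euler_maclaurin_coeff_holomorphic]) auto
    moreover have "continuous_on K (\<lambda>s. 1 - s - of_nat j)"
      by (intro continuous_intros)
    ultimately have "bounded (euler_maclaurin_coeff j ` K)" "bounded ((\<lambda>s. 1 - s - of_nat j) ` K)"
      using assms(1) by (auto intro!: compact_imp_bounded compact_continuous_image)
    then obtain D A where D: "D > 0" "\<And>s. s \<in> K \<Longrightarrow> norm (euler_maclaurin_coeff j s) \<le> D"
      and A: "\<And>s. s \<in> K \<Longrightarrow> norm (1 - s - of_nat j) \<le> A"
      unfolding bounded_pos by blast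
    show ?thesis
    proof (intro exI[of _ "D * (2 powr A * 2 ^ (Suc (Suc N - j)))"] conjI allI impI ballI)
      show "0 \<le> D * (2 powr A * 2 ^ (Suc (Suc N - j)))" using D by simp
      fix n :: nat and s assume n: "n \<ge> 2" and s: "s \<in> K"
      have exponent: "real n powr (1 - Re s - real j) * (1 / n) ^ (Suc (Suc N - j)) =
          real n powr (- Re s - real N - 1)"
      proof -
        have "(1 / real n) ^ (Suc (Suc N - j)) = real n powr (- real (Suc (Suc N - j)))"
          using n by (subst powr_minus, subst powr_realpow) (auto simp: field_simps)
        moreover have "1 - Re s - real j + - real (Suc (Suc N - j)) = - Re s - real N - 1"
          using j by (simp add: of_nat_diff)
        ultimately show ?thesis by (simp only: powr_add [symmetric])
      qed
      have "norm (euler_maclaurin_coeff j s * of_nat n powr (1 - s - of_nat j) *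
         ((1 + of_real (1 / n)) powr (1 - s - of_nat j) -
          (\<Sum>k\<le>Suc N - j. ((1 - s - of_nat j) gchoose k) * of_real (1 / n) ^ k))) \<le>
          D * real n powr (1 - Re s - real j) * (2 powr A * (2 * (1 / n)) ^ (Suc (Suc N - j)))"
        unfolding norm_mult using n s A D
        by (intro mult_mono binomial_series_remainder) (auto simp: norm_powr_real_powr)
      also have "\<dots> = D * (2 powr A * 2 ^ (Suc (Suc N - j))) * real n powr (- Re s - real N - 1)"
        unfolding exponent [symmetric] by (simp only: power_mult_distrib mult_ac)
      finally show "norm (euler_maclaurin_coeff j s * of_nat n powr (1 - s - of_nat j) *
         ((1 + of_real (1 / n)) powr (1 - s - of_nat j) -
          (\<Sum>k\<le>Suc N - j. ((1 - s - of_nat j) gchoose k) * of_real (1 / n) ^ k))) \<le>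
          D * (2 powr A * 2 ^ (Suc (Suc N - j))) * real n powr (- Re s - real N - 1)" .
    qed
  qed
  then have "\<forall>j\<in>{..N}. \<exists>C\<ge>0. \<forall>n\<ge>2. \<forall>s\<in>K.
      norm (euler_maclaurin_coeff j s * of_nat n powr (1 - s - of_nat j) *
       ((1 + of_real (1 / n)) powr (1 - s - of_nat j) -
        (\<Sum>k\<le>Suc N - j. ((1 - s - of_nat j) gchoose k) * of_real (1 / n) ^ k))) \<le>
        C * real n powr (- Re s - real N - 1)" by blast
  from bchoice[OF this] obtain C where C: "\<And>j. j \<le> N \<Longrightarrow> C j \<ge> 0"
    "\<And>j n s. j \<le> N \<Longrightarrow> n \<ge> 2 \<Longrightarrow> s \<in> K \<Longrightarrow>
      norm (euler_maclaurin_coeff j s * of_nat n powr (1 - s - of_nat j) *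
       ((1 + of_real (1 / n)) powr (1 - s - of_nat j) -
        (\<Sum>k\<le>Suc N - j. ((1 - s - of_nat j) gchoose k) * of_real (1 / n) ^ k))) \<le>
        C j * real n powr (- Re s - real N - 1)"
    by blast
  show ?thesis
  proof (intro exI[of _ "sum C {..N}"] conjI allI impI ballI)
    show "0 \<le> sum C {..N}" using C(1) by (intro sum_nonneg) auto
    fix n :: nat and s assume n: "n \<ge> 2" and s: "s \<in> K"
    have "norm (zeta_approx N (Suc n) s - zeta_approx N n s) =
        norm (euler_maclaurin_sum N (Suc n) s - euler_maclaurin_sum N n s - of_nat n powr (- s))"
      using n by (subst norm_minus_cancel [symmetric]) (simp add: zeta_approx_def)
    also have "\<dots> \<le> (\<Sum>j\<le>N. C j * real n powr (- Re s - real N - 1))"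
      using n s assms(2)
      by (subst euler_maclaurin_sum_step) (auto intro!: sum_norm_le C(2) simp del: of_real_divide)
    finally show "norm (zeta_approx N (Suc n) s - zeta_approx N n s) \<le>
        sum C {..N} * real n powr (- Re s - real N - 1)"
      by (simp add: sum_distrib_right)
  qed
qed

text \<open>The steps are at most $C/m^{p+1} \le C/(n^{p-1} m^2)$, and $1/m^2$ is bounded by the telescoping
  difference $1/(m-1) - 1/m$.\<close>
lemma zeta_approx_uniformly_Cauchy:
  assumes "compact K" "1 \<notin> K" "p \<ge> 1" "\<And>s. s \<in> K \<Longrightarrow> Re s \<ge> real p - real N"
  shows "\<exists>C\<ge>0. \<forall>n\<ge>2. \<forall>m\<ge>n. \<forall>s\<in>K. norm (zeta_approx N m s - zeta_approx N n s) \<le> C / real n ^ p"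
proof -
  obtain C where C: "C \<ge> 0" "\<And>n s. n \<ge> 2 \<Longrightarrow> s \<in> K \<Longrightarrow>
      norm (zeta_approx N (Suc n) s - zeta_approx N n s) \<le> C * real n powr (- Re s - real N - 1)"
    using zeta_approx_step_bound[OF assms(1,2), of N] by blast
  show ?thesis
  proof (intro exI[of _ "2 * C"] conjI allI impI ballI)
    show "0 \<le> 2 * C" using C by simp
    fix n m :: nat and s assume n: "n \<ge> 2" and "n \<le> m" and s: "s \<in> K"
    obtain q where q: "p = Suc q" using assms(3) by (cases p) auto
    have "norm (zeta_approx N m s - zeta_approx N n s) \<le>
        C / real n ^ q * (1 / (real n - 1) - 1 / (real m - 1))"
      using \<open>n \<le> m\<close>
    proof (induction m rule: dec_induct)
      case base
      then show ?case by simp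
    next
      case (step m)
      have m: "real m \<ge> 2" "real n \<le> real m" "real n > 0" using step n by auto
      have "norm (zeta_approx N (Suc m) s - zeta_approx N m s) \<le> C * real m powr (- Re s - real N - 1)"
        using step n s by (intro C) auto
      also have "\<dots> \<le> C * real m powr (- real (Suc p))"
        using C(1) m assms(4)[OF s] by (intro mult_left_mono powr_mono) auto
      also have "\<dots> = C / (real m ^ q * real m ^ 2)"
        using m unfolding q by (subst powr_minus, subst powr_realpow)
          (auto simp: divide_inverse power2_eq_square mult_ac)
      also have "\<dots> \<le> C / (real n ^ q * real m ^ 2)"
        using C(1) m by (intro divide_left_mono mult_right_mono power_mono mult_pos_pos) auto
      also have "\<dots> = C / real n ^ q * (1 / real m ^ 2)" by simp
      also have "\<dots> \<le> C / real n ^ q * (1 / (real m - 1) - 1 / real m)"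
      proof (intro mult_left_mono)
        have "1 / (real m - 1) - 1 / real m - 1 / real m ^ 2 = 1 / ((real m - 1) * real m ^ 2)"
          using m by (simp add: field_simps power2_eq_square)
        also have "\<dots> \<ge> 0" using m by simp
        finally show "1 / real m ^ 2 \<le> 1 / (real m - 1) - 1 / real m" by linarith
      qed (use C in auto)
      finally have "norm (zeta_approx N (Suc m) s - zeta_approx N m s) \<le>
          C / real n ^ q * (1 / (real m - 1) - 1 / real m)" .
      with step.IH have "norm ((zeta_approx N m s - zeta_approx N n s) +
          (zeta_approx N (Suc m) s - zeta_approx N m s)) \<le>
          C / real n ^ q * (1 / (real n - 1) - 1 / (real m - 1)) +
          C / real n ^ q * (1 / (real m - 1) - 1 / real m)"
        by (intro norm_triangle_mono)
      then show ?case by (simp add: algebra_simps)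
    qed
    also have "\<dots> \<le> C / real n ^ q * (2 / real n)"
    proof (intro mult_left_mono)
      have "1 / (real n - 1) \<le> 2 / real n" using n by (simp add: field_simps)
      moreover have "1 / (real m - 1) \<ge> 0" using n \<open>n \<le> m\<close> by simp
      ultimately show "1 / (real n - 1) - 1 / (real m - 1) \<le> 2 / real n" by linarith
    qed (use C in auto)
    finally show "norm (zeta_approx N m s - zeta_approx N n s) \<le> 2 * C / real n ^ p"
      by (simp add: q mult_ac)
  qed
qed

section \<open>Analytic continuation of the zeta function\<close>

text \<open>The order of the approximation is chosen pointwise, as the least \<open>N\<close> with $\Re s \ge 1 - N$.
  Any larger order has the same limit by \<open>zeta_approx_tendsto\<close>, which is what makes the function
  holomorphic across the lines where the order jumps.\<close>
definition zeta_continuation :: "complex \<Rightarrow> complex" where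
  "zeta_continuation s = (if s = 1 then 0 else lim (\<lambda>n. zeta_approx (nat \<lceil>1 - Re s\<rceil>) n s))"

text \<open>Raising the order from \<open>M\<close> to \<open>M + 1\<close> changes the approximation by a multiple of $n^{-s-M}$, which tends
  to 0 in the half-plane $\Re s \ge 1 - M$.\<close>
lemma zeta_approx_tendsto:
  assumes "s \<noteq> 1" "Re s \<ge> 1 - real N"
  shows "(\<lambda>n. zeta_approx N n s) \<longlonglongrightarrow> zeta_continuation s"
proof -
  define N0 where "N0 = nat \<lceil>1 - Re s\<rceil>"
  have N0: "Re s \<ge> real 1 - real N0" "N0 \<le> N"
    using assms(2) unfolding N0_def by linarith+
  obtain C where C: "C \<ge> 0"
    "\<And>n m. n \<ge> 2 \<Longrightarrow> m \<ge> n \<Longrightarrow> norm (zeta_approx N0 m s - zeta_approx N0 n s) \<le> C / real n"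
    using zeta_approx_uniformly_Cauchy[of "{s}" 1 N0] assms(1) N0(1) by auto
  have "Cauchy (\<lambda>n. zeta_approx N0 n s)"
  proof (rule metric_CauchyI)
    fix e :: real assume e: "e > 0"
    define M where "M = max 2 (nat \<lceil>2 * C / e\<rceil> + 1)"
    have M: "M \<ge> 2" "real M > 2 * C / e" unfolding M_def by linarith+
    then have small: "2 * (C / real M) < e" using e by (simp add: field_simps)
    have close: "dist (zeta_approx N0 n s) (zeta_approx N0 M s) \<le> C / real M" if "n \<ge> M" for n
      using C(2)[OF M(1) that] by (simp add: dist_norm)
    have "dist (zeta_approx N0 m s) (zeta_approx N0 n s) < e" if "m \<ge> M" "n \<ge> M" for m n
      using close[OF that(1)] close[OF that(2)] small
        dist_triangle2[of "zeta_approx N0 m s" "zeta_approx N0 n s" "zeta_approx N0 M s"]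
      by linarith
    then show "\<exists>M. \<forall>m\<ge>M. \<forall>n\<ge>M. dist (zeta_approx N0 m s) (zeta_approx N0 n s) < e" by blast
  qed
  then have "(\<lambda>n. zeta_approx N0 n s) \<longlonglongrightarrow> zeta_continuation s"
    using assms(1) by (simp add: zeta_continuation_def N0_def Cauchy_convergent_iff convergent_LIMSEQ_iff)
  note limit = this
  show ?thesis
    using N0(2)
  proof (induction N rule: dec_induct)
    case base
    show ?case by (rule limit)
  next
    case (step M)
    have "(\<lambda>n. of_nat n powr (1 - s - of_nat (Suc M)) :: complex) \<longlonglongrightarrow> 0"
      using step N0(1) by (intro tendsto_neg_powr_complex_of_nat filterlim_ident) auto
    then have "(\<lambda>n. euler_maclaurin_coeff (Suc M) s * of_nat n powr (1 - s - of_nat (Suc M))) \<longlonglongrightarrow> 0"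
      by (rule tendsto_mult_right_zero)
    from tendsto_diff[OF step.IH this] show ?case
      by (simp add: zeta_approx_def euler_maclaurin_sum_def algebra_simps)
  qed
qed

lemma zeta_approx_rate:
  assumes "compact K" "1 \<notin> K" "p \<ge> 1" "\<And>s. s \<in> K \<Longrightarrow> Re s \<ge> real p - real N"
  shows "\<exists>C\<ge>0. \<forall>n\<ge>2. \<forall>s\<in>K. norm (zeta_continuation s - zeta_approx N n s) \<le> C / real n ^ p"
proof -
  obtain C where C: "C \<ge> 0" "\<And>n m s. n \<ge> 2 \<Longrightarrow> m \<ge> n \<Longrightarrow> s \<in> K \<Longrightarrow>
      norm (zeta_approx N m s - zeta_approx N n s) \<le> C / real n ^ p"
    using zeta_approx_uniformly_Cauchy[OF assms] by blast
  have "norm (zeta_continuation s - zeta_approx N n s) \<le> C / real n ^ p" if "n \<ge> 2" "s \<in> K" for n s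
  proof (rule Lim_bounded)
    have "s \<noteq> 1" "Re s \<ge> 1 - real N" using that assms(2,3) assms(4)[OF that(2)] by auto
    then show "(\<lambda>m. norm (zeta_approx N m s - zeta_approx N n s)) \<longlonglongrightarrow>
        norm (zeta_continuation s - zeta_approx N n s)"
      by (intro tendsto_intros zeta_approx_tendsto)
    show "\<forall>m\<ge>n. norm (zeta_approx N m s - zeta_approx N n s) \<le> C / real n ^ p"
      using C(2) that by blast
  qed
  then show ?thesis using C(1) by blast
qed

lemma zeta_continuation_holomorphic: "zeta_continuation holomorphic_on - {1}"
proof -
  have "zeta_continuation holomorphic_on ball z (dist z 1 / 2)" if "z \<noteq> 1" for z
  proof -
    define K where "K = cball z (dist z 1 / 2)"
    define N where "N = nat \<lceil>1 - Re z + dist z 1\<rceil>"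
    have K: "compact K" "1 \<notin> K" "K \<subseteq> - {1}" using that by (auto simp: K_def)
    have re: "Re s \<ge> real 1 - real N" if "s \<in> K" for s
    proof -
      have "\<bar>Re (z - s)\<bar> \<le> dist z s" unfolding dist_norm by (rule abs_Re_le_cmod)
      also have "\<dots> \<le> dist z 1 / 2" using that by (auto simp: K_def)
      also have "\<dots> \<le> dist z 1" by simp
      finally have "Re s \<ge> Re z - dist z 1" by simp
      then show ?thesis unfolding N_def by linarith
    qed
    obtain C where C: "C \<ge> 0"
      "\<And>n s. n \<ge> 2 \<Longrightarrow> s \<in> K \<Longrightarrow> norm (zeta_continuation s - zeta_approx N n s) \<le> C / real n"
      using zeta_approx_rate[of K 1 N] K re by auto
    have "uniform_limit K (zeta_approx N) zeta_continuation sequentially"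
    proof (rule uniform_limitI)
      fix e :: real assume e: "e > 0"
      have "(\<lambda>n. C / real n) \<longlonglongrightarrow> 0" by real_asymp
      then have "eventually (\<lambda>n. C / real n < e) sequentially" using e by (rule order_tendstoD)
      then show "eventually (\<lambda>n. \<forall>s\<in>K. dist (zeta_approx N n s) (zeta_continuation s) < e) sequentially"
        using eventually_ge_at_top[of 2]
      proof eventually_elim
        case (elim n)
        then show ?case using C(2)[of n] by (fastforce simp: dist_norm norm_minus_commute)
      qed
    qed
    then show ?thesis
      unfolding K_def
    proof (rule holomorphic_uniform_limit[rotated])
      show "eventually (\<lambda>n. continuous_on (cball z (dist z 1 / 2)) (zeta_approx N n) \<and>
          zeta_approx N n holomorphic_on ball z (dist z 1 / 2)) sequentially"
        using K(3) ball_subset_cball[of z "dist z 1 / 2"] unfolding K_def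
        by (intro always_eventually allI conjI holomorphic_on_imp_continuous_on
            holomorphic_on_subset[OF zeta_approx_holomorphic]) auto
    qed auto
  qed
  then have "zeta_continuation holomorphic_on (\<Union>z\<in>- {1}. ball z (dist z 1 / 2))"
    by (intro holomorphic_on_UN_open) auto
  then show ?thesis
    by (rule holomorphic_on_subset) auto
qed

text \<open>For $\Re s > 1$ the order 0 suffices, and there the correction term $n^{1-s}/(1-s)$ tends to 0, so
  the limit is the Dirichlet series.\<close>
lemma riemann_zeta_eq_zeta_continuation: "riemann_zeta = zeta_continuation"
proof -
  have "is_zeta_continuation zeta_continuation"
    unfolding is_zeta_continuation_def
  proof (intro conjI allI impI)
    fix s :: complex assume s: "Re s > 1"
    have "(\<lambda>n. of_nat n powr (1 - s - of_nat 0) :: complex) \<longlonglongrightarrow> 0"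
      using s by (intro tendsto_neg_powr_complex_of_nat filterlim_ident) simp
    then have "(\<lambda>n. euler_maclaurin_sum 0 n s) \<longlonglongrightarrow> 0"
      by (auto simp: euler_maclaurin_sum_def intro: tendsto_mult_right_zero)
    moreover have "(\<lambda>n. zeta_approx 0 n s) \<longlonglongrightarrow> zeta_continuation s"
      using s by (intro zeta_approx_tendsto) auto
    ultimately have "(\<lambda>n. zeta_approx 0 n s + euler_maclaurin_sum 0 n s) \<longlonglongrightarrow> zeta_continuation s"
      using tendsto_add[of "\<lambda>n. zeta_approx 0 n s" _ _ "\<lambda>n. euler_maclaurin_sum 0 n s" 0] by simp
    then have "(\<lambda>n. zeta_approx 0 (Suc n) s + euler_maclaurin_sum 0 (Suc n) s) \<longlonglongrightarrow> zeta_continuation s"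
      by (rule LIMSEQ_Suc)
    moreover have "zeta_approx 0 (Suc n) s + euler_maclaurin_sum 0 (Suc n) s =
        (\<Sum>k<n. 1 / of_nat (Suc k) powr s)" for n
      by (simp add: zeta_approx_def powr_minus_divide sum.atLeast1_atMost_eq atLeastLessThanSuc_atLeastAtMost
          del: of_nat_Suc)
    ultimately show "(\<lambda>n. 1 / of_nat (Suc n) powr s) sums zeta_continuation s"
      by (simp add: sums_def)
  qed (auto simp: zeta_continuation_def intro: zeta_continuation_holomorphic)
  then show ?thesis
    unfolding riemann_zeta_def by (intro the_equality) (auto intro: is_zeta_continuation_unique)
qed

text \<open>Cauchy's inequality on the disc of radius $\frac12$ about \<open>z\<close>, whose leftmost point has real part
  $\Re z - \frac12$, turns the uniform rate on that disc into a rate for the derivative at its centre.\<close>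
lemma deriv_zeta_approx_rate:
  assumes "1 \<notin> cball z (1 / 2)" "p \<ge> 1" "Re z - 1 / 2 \<ge> real p - real N"
  shows "\<exists>C. \<forall>n\<ge>2. norm (deriv riemann_zeta z - deriv (zeta_approx N n) z) \<le> C / real n ^ p"
proof -
  have re: "Re s \<ge> real p - real N" if "s \<in> cball z (1 / 2)" for s
  proof -
    have "\<bar>Re (z - s)\<bar> \<le> dist z s" unfolding dist_norm by (rule abs_Re_le_cmod)
    then show ?thesis using that assms(3) by auto
  qed
  obtain C where C: "C \<ge> 0" "\<And>n s. n \<ge> 2 \<Longrightarrow> s \<in> cball z (1 / 2) \<Longrightarrow>
      norm (zeta_continuation s - zeta_approx N n s) \<le> C / real n ^ p"
    using zeta_approx_rate[OF compact_cball assms(1,2) re] by blast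
  have sub: "cball z (1 / 2) \<subseteq> - {1}" using assms(1) by auto
  have "norm (deriv riemann_zeta z - deriv (zeta_approx N n) z) \<le> (2 * C) / real n ^ p" if n: "n \<ge> 2" for n
  proof -
    have holo: "(\<lambda>s. zeta_continuation s - zeta_approx N n s) holomorphic_on - {1}"
      by (intro holomorphic_intros zeta_continuation_holomorphic zeta_approx_holomorphic)
    have "norm ((deriv ^^ 1) (\<lambda>s. zeta_continuation s - zeta_approx N n s) z) \<le>
        fact 1 * (C / real n ^ p) / (1 / 2) ^ 1"
    proof (rule Cauchy_inequality)
      show "(\<lambda>s. zeta_continuation s - zeta_approx N n s) holomorphic_on ball z (1 / 2)"
        using sub by (intro holomorphic_on_subset[OF holo]) auto
      show "continuous_on (cball z (1 / 2)) (\<lambda>s. zeta_continuation s - zeta_approx N n s)"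
        using sub by (intro holomorphic_on_imp_continuous_on holomorphic_on_subset[OF holo]) auto
      fix x assume "norm (z - x) = 1 / 2"
      then show "norm (zeta_continuation x - zeta_approx N n x) \<le> C / real n ^ p"
        using n by (intro C) (auto simp: dist_norm)
    qed auto
    moreover have "deriv (\<lambda>s. zeta_continuation s - zeta_approx N n s) z =
        deriv zeta_continuation z - deriv (zeta_approx N n) z"
    proof (rule deriv_diff)
      have z: "open (- {1 :: complex})" "z \<in> - {1}" using assms(1) by auto
      show "zeta_continuation field_differentiable at z"
        by (rule holomorphic_on_imp_differentiable_at[OF zeta_continuation_holomorphic z])
      show "zeta_approx N n field_differentiable at z"
        by (rule holomorphic_on_imp_differentiable_at[OF zeta_approx_holomorphic z])
    qed
    ultimately show ?thesis by (simp add: riemann_zeta_eq_zeta_continuation mult_ac)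
  qed
  then show ?thesis by blast
qed

section \<open>Expansions of the logarithms of factorial and hyperfactorial\<close>
lemma euler_maclaurin_coeff_0: "euler_maclaurin_coeff 0 s = 1 / (1 - s)"
  by (simp add: euler_maclaurin_coeff_def bernoulli_number_values)

lemma euler_maclaurin_coeff_1: "s \<noteq> 1 \<Longrightarrow> euler_maclaurin_coeff (Suc 0) s = - 1 / 2"
  by (simp add: euler_maclaurin_coeff_def bernoulli_number_values of_rat_divide of_rat_minus)

lemma gbinomial_Suc_absorb:
  "(a :: complex) gchoose Suc k = a * ((a - 1) gchoose k) / of_nat (Suc k)"
  using gbinomial_absorption[of k a] by (simp add: field_simps del: of_nat_Suc)

text \<open>The coefficients of index at least 2 vanish at \<open>0\<close> and those of index at least 3 vanish at \<open>-1\<close>.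
  With the root split off as a factor, the derivative at the root is the value of the cofactor.\<close>
lemma euler_maclaurin_coeff_Suc_Suc:
  assumes "s \<noteq> 1"
  shows "euler_maclaurin_coeff (Suc (Suc k)) s =
    s * (- of_rat (bernoulli_number (k + 2)) * ((- s - 1) gchoose k) / (of_nat (k + 1) * of_nat (k + 2)))"
proof -
  have "(1 - s) gchoose Suc (Suc k) = (1 - s) * ((- s) * ((- s - 1) gchoose k)) / (of_nat (k + 1) * of_nat (k + 2))"
    unfolding gbinomial_Suc_absorb by (simp add: mult_ac)
  then show ?thesis using assms by (simp add: euler_maclaurin_coeff_def)
qed

lemma euler_maclaurin_coeff_Suc_Suc_Suc:
  assumes "s \<noteq> 1"
  shows "euler_maclaurin_coeff (Suc (Suc (Suc k))) s =
    (s + 1) * (of_rat (bernoulli_number (k + 3)) * s * ((- s - 2) gchoose k) /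
      (of_nat (k + 1) * of_nat (k + 2) * of_nat (k + 3)))"
proof -
  define b where "b = complex_of_rat (bernoulli_number (k + 3))"
  define y where "y = (- s - 2) gchoose k"
  have "(- s - 1) gchoose Suc k = (- s - 1) * y / of_nat (k + 1)"
    using gbinomial_Suc_absorb[of "- s - 1" k] by (simp add: y_def algebra_simps)
  moreover have "Suc k + 1 = k + 2" "Suc k + 2 = k + 3" by simp_all
  ultimately have "euler_maclaurin_coeff (Suc (Suc (Suc k))) s =
      s * (- b * ((- s - 1) * y / of_nat (k + 1)) / (of_nat (k + 2) * of_nat (k + 3)))"
    using euler_maclaurin_coeff_Suc_Suc[OF assms, of "Suc k"] by (simp only: b_def)
  also have "\<dots> = (s + 1) * (b * s * y / (of_nat (k + 1) * of_nat (k + 2) * of_nat (k + 3)))"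
  proof -
    have "s * (- b * ((- s - 1) * y / p) / (q * r)) = (s + 1) * (b * s * y / (p * q * r))" for p q r
      by (simp add: divide_inverse algebra_simps)
    then show ?thesis .
  qed
  finally show ?thesis by (simp only: b_def y_def)
qed

lemma deriv_eq_cofactor_at_root:
  fixes f g :: "complex \<Rightarrow> complex"
  assumes "g field_differentiable at z" "open S" "z \<in> S" "\<And>s. s \<in> S \<Longrightarrow> f s = (s - z) * g s"
  shows "deriv f z = g z"
proof -
  have "((\<lambda>s. (s - z) * g s) has_field_derivative (1 - 0) * g z + deriv g z * (z - z)) (at z)"
    using assms(1) by (intro derivative_intros) (auto simp: DERIV_deriv_iff_field_differentiable)
  then have "(f has_field_derivative (1 - 0) * g z + deriv g z * (z - z)) (at z)"
    by (rule has_field_derivative_transform_within_open[OF _ assms(2,3)]) (simp add: assms(4))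
  then show ?thesis by (simp add: DERIV_imp_deriv)
qed

lemma gbinomial_minus_one: "(- 1 :: complex) gchoose k = (- 1) ^ k"
  using gbinomial_minus[of "1 :: complex" k] by (simp flip: binomial_gbinomial)

lemma deriv_euler_maclaurin_coeff_0:
  assumes "z \<noteq> 1"
  shows "deriv (euler_maclaurin_coeff 0) z = 1 / (1 - z) ^ 2"
proof (rule DERIV_imp_deriv)
  show "(euler_maclaurin_coeff 0 has_field_derivative 1 / (1 - z) ^ 2) (at z)"
    unfolding euler_maclaurin_coeff_0 [abs_def] using assms
    by (auto intro!: derivative_eq_intros simp: power2_eq_square)
qed

lemma deriv_euler_maclaurin_coeff_1:
  assumes "z \<noteq> 1"
  shows "deriv (euler_maclaurin_coeff (Suc 0)) z = 0"
proof (rule DERIV_imp_deriv)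
  show "(euler_maclaurin_coeff (Suc 0) has_field_derivative 0) (at z)"
    by (rule has_field_derivative_transform_within_open[of "\<lambda>_. - 1 / 2" _ _ "- {1}"])
       (use assms in \<open>auto simp: euler_maclaurin_coeff_1\<close>)
qed

lemma deriv_euler_maclaurin_coeff_at_0:
  "deriv (euler_maclaurin_coeff (Suc (Suc k))) 0 =
     - ((- 1) ^ k * of_rat (bernoulli_number (k + 2)) / (of_nat (k + 1) * of_nat (k + 2)))"
proof -
  have "(\<lambda>s :: complex. - of_rat (bernoulli_number (k + 2)) * ((- s - 1) gchoose k) /
      (of_nat (k + 1) * of_nat (k + 2))) analytic_on {0}"
    by (intro analytic_intros) (simp del: of_nat_Suc of_nat_add add_2_eq_Suc')
  then have "deriv (euler_maclaurin_coeff (Suc (Suc k))) 0 = - of_rat (bernoulli_number (k + 2)) *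
      ((- 0 - 1) gchoose k) / (of_nat (k + 1) * of_nat (k + 2))"
    by (intro deriv_eq_cofactor_at_root[where S = "- {1}"] analytic_on_imp_differentiable_at)
       (auto simp: euler_maclaurin_coeff_Suc_Suc)
  then show ?thesis by (simp add: gbinomial_minus_one mult_ac)
qed

lemma deriv_euler_maclaurin_coeff_at_minus_1:
  "deriv (euler_maclaurin_coeff (Suc (Suc (Suc k)))) (- 1) =
     - ((- 1) ^ k * of_rat (bernoulli_number (k + 3)) / (of_nat (k + 1) * of_nat (k + 2) * of_nat (k + 3)))"
proof -
  have "(\<lambda>s :: complex. of_rat (bernoulli_number (k + 3)) * s * ((- s - 2) gchoose k) /
      (of_nat (k + 1) * of_nat (k + 2) * of_nat (k + 3))) analytic_on {- 1}"
    by (intro analytic_intros) (simp del: of_nat_Suc of_nat_add add_2_eq_Suc')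
  then have "deriv (euler_maclaurin_coeff (Suc (Suc (Suc k)))) (- 1) =
      of_rat (bernoulli_number (k + 3)) * (- 1) * ((- (- 1) - 2) gchoose k) /
      (of_nat (k + 1) * of_nat (k + 2) * of_nat (k + 3))"
    by (intro deriv_eq_cofactor_at_root[where S = "- {1}"] analytic_on_imp_differentiable_at)
       (auto simp: euler_maclaurin_coeff_Suc_Suc_Suc)
  then show ?thesis by (simp add: gbinomial_minus_one mult_ac)
qed

lemma deriv_euler_maclaurin_coeff_2_at_minus_1:
  "deriv (euler_maclaurin_coeff (Suc (Suc 0))) (- 1) = - 1 / 12"
proof (rule DERIV_imp_deriv)
  show "(euler_maclaurin_coeff (Suc (Suc 0)) has_field_derivative - 1 / 12) (at (- 1))"
    by (rule has_field_derivative_transform_within_open[of "\<lambda>s. - s / 12" _ _ "- {1}"])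
       (auto intro!: derivative_eq_intros
         simp: euler_maclaurin_coeff_Suc_Suc bernoulli_number_values of_rat_divide)
qed

lemma deriv_zeta_approx:
  assumes "z \<noteq> 1" "n \<ge> 1"
  shows "deriv (zeta_approx N n) z =
    - (\<Sum>k = 1..<n. of_real (ln (real k)) * of_nat k powr (- z)) -
    (\<Sum>j\<le>N. (deriv (euler_maclaurin_coeff j) z - euler_maclaurin_coeff j z * of_real (ln (real n))) *
       of_nat n powr (1 - z - of_nat j))"
proof (rule DERIV_imp_deriv)
  have coeff: "(euler_maclaurin_coeff j has_field_derivative deriv (euler_maclaurin_coeff j) z) (at z)" for j
    using assms(1)
    by (intro holomorphic_derivI[OF euler_maclaurin_coeff_holomorphic]) auto
  have powr: "((\<lambda>s. of_nat k powr f s) has_field_derivative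
      - (of_real (ln (real k)) * of_nat k powr f z)) (at z)"
    if "k \<ge> 1" "(f has_field_derivative - 1) (at z)" for k f
    using DERIV_chain2[OF has_field_derivative_powr_right that(2), of "of_nat k"] that(1)
    by (simp add: Ln_of_nat)
  have powr1: "((\<lambda>s. of_nat k powr (- s)) has_field_derivative
      - (of_real (ln (real k)) * of_nat k powr (- z))) (at z)" if "k \<ge> 1" for k
    by (rule powr[OF that]) (auto intro!: derivative_eq_intros)
  have powr2: "((\<lambda>s. of_nat n powr (1 - s - of_nat j)) has_field_derivative
      - (of_real (ln (real n)) * of_nat n powr (1 - z - of_nat j))) (at z)" for j
    by (rule powr[OF assms(2)]) (auto intro!: derivative_eq_intros)
  have "((\<lambda>s. (\<Sum>k = 1..<n. of_nat k powr (- s)) -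
      (\<Sum>j\<le>N. euler_maclaurin_coeff j s * of_nat n powr (1 - s - of_nat j))) has_field_derivative
      (\<Sum>k = 1..<n. - (of_real (ln (real k)) * of_nat k powr (- z))) -
      (\<Sum>j\<le>N. deriv (euler_maclaurin_coeff j) z * of_nat n powr (1 - z - of_nat j) +
         - (of_real (ln (real n)) * of_nat n powr (1 - z - of_nat j)) * euler_maclaurin_coeff j z)) (at z)"
    by (intro DERIV_diff DERIV_sum DERIV_mult coeff powr1 powr2) auto
  then show "(zeta_approx N n has_field_derivative
    - (\<Sum>k = 1..<n. of_real (ln (real k)) * of_nat k powr (- z)) -
    (\<Sum>j\<le>N. (deriv (euler_maclaurin_coeff j) z - euler_maclaurin_coeff j z * of_real (ln (real n))) *
       of_nat n powr (1 - z - of_nat j))) (at z)"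
    unfolding zeta_approx_def [abs_def] euler_maclaurin_sum_def
    by (simp add: sum_negf algebra_simps)
qed

lemma complex_of_rat: "(of_rat q :: complex) = of_real (of_rat q)"
  by (cases q) (simp add: of_rat_rat)

text \<open>Only the coefficients of index 0 and 1 contribute logarithms, because the others vanish at \<open>0\<close>. A
  similar computation at \<open>-1\<close> follows, where index 2 contributes as well.\<close>
lemma deriv_zeta_approx_at_0:
  assumes "n \<ge> 1"
  shows "deriv (zeta_approx (Suc (Suc M)) n) 0 =
    of_real (- (\<Sum>k = 1..<n. ln (real k)) - (real n - real n * ln (real n) + ln (real n) / 2) +
      (\<Sum>k\<le>M. (- 1) ^ k * of_rat (bernoulli_number (k + 2)) / (real (k + 1) * real (k + 2)) /
         real n ^ (k + 1)))"
proof -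
  have tail: "(deriv (euler_maclaurin_coeff (Suc (Suc k))) 0 -
        euler_maclaurin_coeff (Suc (Suc k)) 0 * of_real (ln (real n))) *
        of_nat n powr (1 - 0 - of_nat (Suc (Suc k))) =
      - of_real ((- 1) ^ k * of_rat (bernoulli_number (k + 2)) / (real (k + 1) * real (k + 2)) /
         real n ^ (k + 1))" for k
  proof -
    have "(1 - 0 - of_nat (Suc (Suc k)) :: complex) = - of_nat (k + 1)" by simp
    then have "(of_nat n :: complex) powr (1 - 0 - of_nat (Suc (Suc k))) = of_real (1 / real n ^ (k + 1))"
      using assms by (simp only: powr_minus powr_nat) (simp add: field_simps)
    moreover have "euler_maclaurin_coeff (Suc (Suc k)) 0 = 0"
      by (simp add: euler_maclaurin_coeff_Suc_Suc)
    ultimately show ?thesis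
      by (simp only: deriv_euler_maclaurin_coeff_at_0 complex_of_rat) simp
  qed
  show ?thesis
    using assms
    by (subst deriv_zeta_approx)
       (simp_all only: sum.atMost_Suc_shift tail sum_negf,
        simp_all add: deriv_euler_maclaurin_coeff_0 deriv_euler_maclaurin_coeff_1
          euler_maclaurin_coeff_0 euler_maclaurin_coeff_1 algebra_simps)
qed

lemma deriv_zeta_approx_at_minus_1:
  assumes "n \<ge> 1"
  shows "deriv (zeta_approx (Suc (Suc (Suc M))) n) (- 1) =
    of_real (- (\<Sum>k = 1..<n. real k * ln (real k)) -
      (real n ^ 2 / 4 - real n ^ 2 / 2 * ln (real n) + real n / 2 * ln (real n) - 1 / 12 - ln (real n) / 12) +
      (\<Sum>k\<le>M. (- 1) ^ k * of_rat (bernoulli_number (k + 3)) /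
         (real (k + 1) * real (k + 2) * real (k + 3)) / real n ^ (k + 1)))"
proof -
  have tail: "(deriv (euler_maclaurin_coeff (Suc (Suc (Suc k)))) (- 1) -
        euler_maclaurin_coeff (Suc (Suc (Suc k))) (- 1) * of_real (ln (real n))) *
        of_nat n powr (1 - (- 1) - of_nat (Suc (Suc (Suc k)))) =
      - of_real ((- 1) ^ k * of_rat (bernoulli_number (k + 3)) /
         (real (k + 1) * real (k + 2) * real (k + 3)) / real n ^ (k + 1))" for k
  proof -
    have "(1 - (- 1) - of_nat (Suc (Suc (Suc k))) :: complex) = - of_nat (k + 1)" by simp
    then have "(of_nat n :: complex) powr (1 - (- 1) - of_nat (Suc (Suc (Suc k)))) =
        of_real (1 / real n ^ (k + 1))"
      using assms by (simp only: powr_minus powr_nat) (simp add: field_simps)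
    moreover have "euler_maclaurin_coeff (Suc (Suc (Suc k))) (- 1) = 0"
      by (simp add: euler_maclaurin_coeff_Suc_Suc_Suc)
    ultimately show ?thesis
      by (simp only: deriv_euler_maclaurin_coeff_at_minus_1 complex_of_rat) simp
  qed
  have coeff2: "euler_maclaurin_coeff (Suc (Suc 0)) (- 1) = 1 / 12"
    by (simp add: euler_maclaurin_coeff_Suc_Suc bernoulli_number_values of_rat_divide)
  have square: "(of_nat n :: complex) powr 2 = of_nat n ^ 2"
    using assms powr_nat[of "of_nat n :: complex" 2] by simp
  show ?thesis
    using assms
    by (subst deriv_zeta_approx)
       (simp_all only: sum.atMost_Suc_shift tail sum_negf,
        simp_all add: deriv_euler_maclaurin_coeff_0 deriv_euler_maclaurin_coeff_1
          deriv_euler_maclaurin_coeff_2_at_minus_1 coeff2 square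
          euler_maclaurin_coeff_0 euler_maclaurin_coeff_1 algebra_simps)
qed

text \<open>The error estimate obtained from the Cauchy inequality has the order of the last term of the sum, so that
  term can be absorbed into the error.\<close>
lemma drop_last_term_of_expansion:
  fixes x :: "nat \<Rightarrow> real"
  assumes "\<forall>n\<ge>2. \<bar>x n - (\<Sum>k\<le>M. c k / real n ^ (k + 1))\<bar> \<le> C / real n ^ (M + 1)"
  shows "\<forall>n\<ge>2. \<bar>x n - (\<Sum>k<M. c k / real n ^ (k + 1))\<bar> \<le> (C + \<bar>c M\<bar>) / real n ^ (M + 1)"
proof (intro allI impI)
  fix n :: nat assume "n \<ge> 2"
  then have "\<bar>x n - (\<Sum>k\<le>M. c k / real n ^ (k + 1))\<bar> \<le> C / real n ^ (M + 1)"
    using assms by blast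
  moreover have "(\<Sum>k\<le>M. c k / real n ^ (k + 1)) = (\<Sum>k<M. c k / real n ^ (k + 1)) + c M / real n ^ (M + 1)"
    by (simp only: lessThan_Suc_atMost [symmetric] sum.lessThan_Suc)
  moreover have "\<bar>c M / real n ^ (M + 1)\<bar> = \<bar>c M\<bar> / real n ^ (M + 1)"
    by (simp add: abs_divide)
  ultimately show "\<bar>x n - (\<Sum>k<M. c k / real n ^ (k + 1))\<bar> \<le> (C + \<bar>c M\<bar>) / real n ^ (M + 1)"
    unfolding add_divide_distrib by linarith
qed

text \<open>The Stirling series, with its constant expressed by $\zeta'(0)$.\<close>
lemma ln_fact_expansion_zeta:
  "\<exists>C. \<forall>n\<ge>2. \<bar>ln (fact n) -
      (real n * ln (real n) - real n + ln (real n) / 2 - Re (deriv riemann_zeta 0)) -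
      (\<Sum>k<M. (- 1) ^ k * of_rat (bernoulli_number (k + 2)) / (real (k + 1) * real (k + 2)) /
         real n ^ (k + 1))\<bar> \<le> C / real n ^ (M + 1)"
proof -
  obtain C where C: "\<And>n. n \<ge> 2 \<Longrightarrow>
      norm (deriv riemann_zeta 0 - deriv (zeta_approx (Suc (Suc M)) n) 0) \<le> C / real n ^ (M + 1)"
    using deriv_zeta_approx_rate[of 0 "M + 1" "Suc (Suc M)"] by auto
  have *: "\<forall>n\<ge>2. \<bar>ln (fact n) -
      (real n * ln (real n) - real n + ln (real n) / 2 - Re (deriv riemann_zeta 0)) -
      (\<Sum>k\<le>M. (- 1) ^ k * of_rat (bernoulli_number (k + 2)) / (real (k + 1) * real (k + 2)) /
         real n ^ (k + 1))\<bar> \<le> C / real n ^ (M + 1)"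
  proof (intro allI impI)
    fix n :: nat assume n: "n \<ge> 2"
    then obtain m where m: "n = Suc m" "m \<ge> 1" by (cases n) auto
    have "ln (fact n) = (\<Sum>k = 1..n. ln (real k))"
      unfolding fact_prod of_nat_prod by (subst ln_prod) auto
    also have "\<dots> = (\<Sum>k = 1..<n. ln (real k)) + ln (real n)"
      using m by (simp add: atLeastLessThanSuc_atLeastAtMost)
    finally have "(\<Sum>k = 1..<n. ln (real k)) = ln (fact n) - ln (real n)" by simp
    moreover have "\<bar>Re (deriv riemann_zeta 0 - deriv (zeta_approx (Suc (Suc M)) n) 0)\<bar> \<le> C / real n ^ (M + 1)"
      using C[OF n] abs_Re_le_cmod order_trans by blast
    ultimately show "\<bar>ln (fact n) -
        (real n * ln (real n) - real n + ln (real n) / 2 - Re (deriv riemann_zeta 0)) -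
        (\<Sum>k\<le>M. (- 1) ^ k * of_rat (bernoulli_number (k + 2)) / (real (k + 1) * real (k + 2)) /
         real n ^ (k + 1))\<bar> \<le> C / real n ^ (M + 1)"
      using n by (simp only: deriv_zeta_approx_at_0 minus_complex.sel Re_complex_of_real)
  qed
  show ?thesis by (rule exI, rule drop_last_term_of_expansion[OF *])
qed

lemma ln_hyperfactorial_expansion:
  "\<exists>C. \<forall>n\<ge>2. \<bar>(\<Sum>k = 1..n. real k * ln (real k)) -
      ((real n ^ 2 / 2 + real n / 2 + 1 / 12) * ln (real n) - real n ^ 2 / 4 + ln glaisher_kinkelin) -
      (\<Sum>k<M. (- 1) ^ k * of_rat (bernoulli_number (k + 3)) /
         (real (k + 1) * real (k + 2) * real (k + 3)) / real n ^ (k + 1))\<bar> \<le> C / real n ^ (M + 1)"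
proof -
  have "1 \<notin> cball (- 1 :: complex) (1 / 2)" by (simp add: dist_norm)
  then obtain C where C: "\<And>n. n \<ge> 2 \<Longrightarrow>
      norm (deriv riemann_zeta (- 1) - deriv (zeta_approx (Suc (Suc (Suc M))) n) (- 1)) \<le> C / real n ^ (M + 1)"
    using deriv_zeta_approx_rate[of "- 1" "M + 1" "Suc (Suc (Suc M))"] by auto
  have *: "\<forall>n\<ge>2. \<bar>(\<Sum>k = 1..n. real k * ln (real k)) -
      ((real n ^ 2 / 2 + real n / 2 + 1 / 12) * ln (real n) - real n ^ 2 / 4 + ln glaisher_kinkelin) -
      (\<Sum>k\<le>M. (- 1) ^ k * of_rat (bernoulli_number (k + 3)) /
         (real (k + 1) * real (k + 2) * real (k + 3)) / real n ^ (k + 1))\<bar> \<le> C / real n ^ (M + 1)"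
  proof (intro allI impI)
    fix n :: nat assume n: "n \<ge> 2"
    then obtain m where m: "n = Suc m" "m \<ge> 1" by (cases n) auto
    have "(\<Sum>k = 1..n. real k * ln (real k)) = (\<Sum>k = 1..<n. real k * ln (real k)) + real n * ln (real n)"
      using m by (simp add: atLeastLessThanSuc_atLeastAtMost)
    then have "(\<Sum>k = 1..<n. real k * ln (real k)) = (\<Sum>k = 1..n. real k * ln (real k)) - real n * ln (real n)"
      by simp
    moreover have "\<bar>Re (deriv riemann_zeta (- 1) - deriv (zeta_approx (Suc (Suc (Suc M))) n) (- 1))\<bar>
        \<le> C / real n ^ (M + 1)"
      using C[OF n] abs_Re_le_cmod order_trans by blast
    ultimately show "\<bar>(\<Sum>k = 1..n. real k * ln (real k)) -
      ((real n ^ 2 / 2 + real n / 2 + 1 / 12) * ln (real n) - real n ^ 2 / 4 + ln glaisher_kinkelin) -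
      (\<Sum>k\<le>M. (- 1) ^ k * of_rat (bernoulli_number (k + 3)) /
         (real (k + 1) * real (k + 2) * real (k + 3)) / real n ^ (k + 1))\<bar> \<le> C / real n ^ (M + 1)"
      using n by (simp only: deriv_zeta_approx_at_minus_1 minus_complex.sel Re_complex_of_real
          glaisher_kinkelin_def ln_exp;
          simp add: algebra_simps)
  qed
  show ?thesis by (rule exI, rule drop_last_term_of_expansion[OF *])
qed

lemma wallis_product_fact:
  "(\<Prod>k = 1..n. (4 * real k ^ 2) / (4 * real k ^ 2 - 1)) =
     2 ^ (4 * n) * fact n ^ 4 / (fact (2 * n) ^ 2 * real (2 * n + 1))"
proof (induction n)
  case (Suc n)
  have "4 * real (Suc n) ^ 2 - 1 = real (2 * n + 1) * real (2 * n + 3)"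
    by (simp add: power2_eq_square algebra_simps)
  then have "(\<Prod>k = 1..Suc n. (4 * real k ^ 2) / (4 * real k ^ 2 - 1)) =
      2 ^ (4 * n) * fact n ^ 4 / (fact (2 * n) ^ 2 * real (2 * n + 1)) *
      ((4 * real (Suc n) ^ 2) / (real (2 * n + 1) * real (2 * n + 3)))"
    by (simp only: prod.nat_ivl_Suc' Suc mult.commute)
  also have "\<dots> = 2 ^ (4 * Suc n) * fact (Suc n) ^ 4 / (fact (2 * Suc n) ^ 2 * real (2 * Suc n + 1))"
  proof -
    have f: "fact (2 * Suc n) = real (2 * n + 2) * real (2 * n + 1) * fact (2 * n)"
      by (simp add: algebra_simps)
    have g: "fact (Suc n) = real (Suc n) * fact n" by simp
    have h: "real (2 * n + 2) = 2 * real (Suc n)" by simp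
    have p: "(2 :: real) ^ (4 * Suc n) = 16 * 2 ^ (4 * n)" by (simp add: power_add)
    have i: "real (2 * Suc n + 1) = real (2 * n + 3)" by simp
    have nz: "real (Suc n) \<noteq> 0" "real (2 * n + 1) \<noteq> 0" "real (2 * n + 3) \<noteq> 0" "fact (2 * n) \<noteq> (0 :: real)"
      by (auto simp del: of_nat_Suc of_nat_add)
    show ?thesis
      unfolding f g h i p using nz
      by (simp add: divide_simps power_mult_distrib power2_eq_square power4_eq_xxxx
          del: of_nat_Suc of_nat_add of_nat_mult)
  qed
  finally show ?case .
qed simp

text \<open>The Stirling series to order 0, inserted into the logarithm of Wallis' product, determines its
  constant.\<close>
lemma Re_deriv_riemann_zeta_0: "Re (deriv riemann_zeta 0) = - ln (2 * pi) / 2"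
proof -
  define K where "K = - Re (deriv riemann_zeta 0)"
  define a where "a n = ln (fact n) - (real n * ln (real n) - real n + ln (real n) / 2)" for n
  obtain C where C: "\<And>n. n \<ge> 2 \<Longrightarrow> \<bar>a n - K\<bar> \<le> C / real n"
    using ln_fact_expansion_zeta[of 0] by (auto simp: a_def K_def algebra_simps)
  have a: "a \<longlonglongrightarrow> K"
  proof (rule LIM_zero_cancel, rule Lim_null_comparison)
    show "eventually (\<lambda>n. norm (a n - K) \<le> C / real n) sequentially"
      using C by (auto intro: eventually_sequentiallyI[of 2])
    show "(\<lambda>n. C / real n) \<longlonglongrightarrow> 0" by real_asymp
  qed
  have a2: "(\<lambda>n. a (2 * n)) \<longlonglongrightarrow> K"
    by (rule filterlim_compose[OF a]) (rule filterlim_subseq, simp add: strict_mono_def)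
  have "(\<lambda>n. ln (\<Prod>k = 1..n. (4 * real k ^ 2) / (4 * real k ^ 2 - 1))) \<longlonglongrightarrow> ln (pi / 2)"
    by (intro tendsto_ln wallis) auto
  moreover have "eventually (\<lambda>n. ln (\<Prod>k = 1..n. (4 * real k ^ 2) / (4 * real k ^ 2 - 1)) =
      4 * a n - 2 * a (2 * n) + (ln (real n) - ln 2 - ln (2 * real n + 1))) sequentially"
    using eventually_gt_at_top[of 0]
  proof eventually_elim
    case (elim n)
    have "ln (\<Prod>k = 1..n. (4 * real k ^ 2) / (4 * real k ^ 2 - 1)) =
        4 * real n * ln 2 + 4 * ln (fact n) - 2 * ln (fact (2 * n)) - ln (2 * real n + 1)"
      unfolding wallis_product_fact by (simp add: ln_div ln_mult ln_realpow add_pos_pos)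
    moreover have "ln (real (2 * n)) = ln 2 + ln (real n)" using elim by (simp add: ln_mult)
    ultimately show ?case
      unfolding a_def by (simp only:) (simp add: algebra_simps add_divide_distrib diff_divide_distrib)
  qed
  ultimately have "(\<lambda>n. 4 * a n - 2 * a (2 * n) + (ln (real n) - ln 2 - ln (2 * real n + 1))) \<longlonglongrightarrow> ln (pi / 2)"
    by (rule Lim_transform_eventually)
  moreover have "(\<lambda>n. ln (real n) - ln 2 - ln (2 * real n + 1)) \<longlonglongrightarrow> - 2 * ln 2"
    by real_asymp
  then have "(\<lambda>n. 4 * a n - 2 * a (2 * n) + (ln (real n) - ln 2 - ln (2 * real n + 1))) \<longlonglongrightarrow>
      4 * K - 2 * K + - 2 * ln 2"
    by (intro tendsto_intros a a2)
  ultimately have "ln (pi / 2) = 4 * K - 2 * K + - 2 * ln 2"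
    by (rule LIMSEQ_unique)
  then show ?thesis by (simp add: K_def ln_div ln_mult)
qed

lemma ln_fact_expansion:
  "\<exists>C. \<forall>n\<ge>2. \<bar>ln (fact n) -
      (real n * ln (real n) - real n + ln (real n) / 2 + ln (2 * pi) / 2) -
      (\<Sum>k<M. (- 1) ^ k * of_rat (bernoulli_number (k + 2)) / (real (k + 1) * real (k + 2)) /
         real n ^ (k + 1))\<bar> \<le> C / real n ^ (M + 1)"
  using ln_fact_expansion_zeta[of M] by (simp add: Re_deriv_riemann_zeta_0)

section \<open>Expansion of the binomial products\<close>

text \<open>The exponent of \<open>k\<close> in $\prod_{j\le n} j!$ is \<open>n + 1 - k\<close>.\<close>
lemma sum_ln_fact:
  "(\<Sum>j\<le>n. ln (fact j)) = real (n + 1) * ln (fact n) - (\<Sum>k = 1..n. real k * ln (real k))"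
proof (induction n)
  case (Suc n)
  have "ln (fact (Suc n)) = ln (real (Suc n)) + ln (fact n)"
    by (simp add: ln_mult del: of_nat_Suc)
  with Suc show ?case
    by (simp add: algebra_simps del: fact_Suc)
qed simp

lemma ln_binomial_product:
  "ln (real (binomial_product n)) = 2 * (\<Sum>k = 1..n. real k * ln (real k)) - real (n + 1) * ln (fact n)"
proof -
  have "ln (real (binomial_product n)) = (\<Sum>j = 1..n. ln (real (n choose j)))"
    unfolding binomial_product_def of_nat_prod by (subst ln_prod) auto
  also have "\<dots> = (\<Sum>j\<le>n. ln (real (n choose j)))"
    by (simp add: sum.atMost_shift sum.atLeast1_atMost_eq)
  also have "\<dots> = (\<Sum>j\<le>n. ln (fact n) - ln (fact j) - ln (fact (n - j)))"
    by (intro sum.cong refl) (simp add: binomial_fact ln_div ln_mult)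
  also have "\<dots> = real (n + 1) * ln (fact n) - (\<Sum>j\<le>n. ln (fact j)) - (\<Sum>j\<le>n. ln (fact (n - j)))"
    by (simp add: sum_subtractf)
  also have "(\<Sum>j\<le>n. ln (fact (n - j))) = (\<Sum>j\<le>n. ln (fact j) :: real)"
    by (rule sum.reindex_bij_witness[of _ "\<lambda>j. n - j" "\<lambda>j. n - j"]) auto
  finally show ?thesis by (simp add: sum_ln_fact)
qed

text \<open>As $B_3 = B_5 = \dots = 0$, these are $-B_{j+1}/(j(j+1))$ for odd and $-B_{j+2}/(j(j+1))$ for even
  \<open>j \<ge> 1\<close>.\<close>
definition binomial_product_coeff :: "nat \<Rightarrow> rat" where
  "binomial_product_coeff j =
     (- 1) ^ j * (bernoulli_number (Suc j) - bernoulli_number (Suc (Suc j))) / of_nat (j * Suc j)"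

lemma computable_binomial_product_coeff: "computable_rat_seq binomial_product_coeff"
  unfolding binomial_product_coeff_def [abs_def]
  by (intro computable_rat_seqI recursive_rat_function_divide_nat recursive_rat_function_mult
      recursive_rat_function_minus_one_power recursive_rat_function_diff
      recursive_rat_function_bernoulli_number recursive_function_mult recursive_function_intros)

text \<open>The three terms are the contributions of twice the logarithm of the hyperfactorial, of
  $-n \log n!$, whose series is shifted by one power of \<open>n\<close>, and of $-\log n!$.\<close>
lemma binomial_product_coeff_decompose:
  "real_of_rat (binomial_product_coeff (Suc k)) =
     2 * ((- 1) ^ k * of_rat (bernoulli_number (k + 3)) / (real (k + 1) * real (k + 2) * real (k + 3)))
     - (- 1) ^ Suc k * of_rat (bernoulli_number (Suc k + 2)) / (real (Suc k + 1) * real (Suc k + 2))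
     - (- 1) ^ k * of_rat (bernoulli_number (k + 2)) / (real (k + 1) * real (k + 2))"
proof -
  define b where "b = real_of_rat (bernoulli_number (k + 3))"
  define c where "c = real_of_rat (bernoulli_number (k + 2))"
  have "real_of_rat (binomial_product_coeff (Suc k)) = (- 1) ^ Suc k * (c - b) / (real (k + 1) * real (k + 2))"
    unfolding binomial_product_coeff_def b_def c_def
    by (simp add: of_rat_mult of_rat_divide of_rat_diff of_rat_power of_rat_minus numeral_3_eq_3
        of_rat_add algebra_simps)
  moreover have "(- 1) ^ Suc k * (c - b) / (x * y) =
      2 * ((- 1) ^ k * b / (x * y * z)) - (- 1) ^ Suc k * b / (y * z) - (- 1) ^ k * c / (x * y)"
    if "x > 0" "y > 0" "z = x + 2" for x y z :: real
    using that by (simp add: divide_simps) (simp add: algebra_simps)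
  moreover have "Suc k + 1 = k + 2" "Suc k + 2 = k + 3" "real (k + 3) = real (k + 1) + 2"
    "real (k + 1) > 0" "real (k + 2) > 0" by simp_all
  ultimately show ?thesis
    unfolding b_def c_def by metis
qed

theorem theorem9p2:
  "\<exists>g :: nat \<Rightarrow> rat. computable_rat_seq g \<and>
     (\<forall>N \<ge> 1. \<exists>C :: real. \<forall>n :: nat. n \<ge> 2 \<longrightarrow>
        \<bar>ln (real (binomial_product n)) -
          (1 / 2 * real n ^ 2 - 1 / 2 * real n * ln (real n)
           + (1 - 1 / 2 * ln (2 * pi)) * real n - 1 / 3 * ln (real n)
           + (- 1 / 2 * ln (2 * pi) - 1 / 12 + 2 * ln glaisher_kinkelin)
           + (\<Sum>j = 1..N. real_of_rat (g j) * (1 / real n ^ j)))\<bar>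
        \<le> C * (1 / real n ^ (N + 1)))"
proof (intro exI[of _ binomial_product_coeff] conjI allI impI computable_binomial_product_coeff)
  fix N :: nat
  define h where "h k = (- 1) ^ k * of_rat (bernoulli_number (k + 3)) /
    (real (k + 1) * real (k + 2) * real (k + 3))" for k
  define f where "f k = (- 1) ^ k * of_rat (bernoulli_number (k + 2)) / (real (k + 1) * real (k + 2))" for k
  define H where "H n = (\<Sum>k = 1..n. real k * ln (real k)) -
      ((real n ^ 2 / 2 + real n / 2 + 1 / 12) * ln (real n) - real n ^ 2 / 4 + ln glaisher_kinkelin)" for n
  define L where "L n = ln (fact n) - (real n * ln (real n) - real n + ln (real n) / 2 + ln (2 * pi) / 2)" for n
  obtain C1 where C1: "\<And>n. n \<ge> 2 \<Longrightarrow> \<bar>H n - (\<Sum>k<N. h k / real n ^ (k + 1))\<bar> \<le> C1 / real n ^ (N + 1)"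
    using ln_hyperfactorial_expansion[of N] unfolding H_def h_def by blast
  obtain C2 where C2: "\<And>n. n \<ge> 2 \<Longrightarrow> \<bar>L n - (\<Sum>k<N. f k / real n ^ (k + 1))\<bar> \<le> C2 / real n ^ (N + 1)"
    using ln_fact_expansion[of N] unfolding L_def f_def by blast
  \<comment> \<open>Multiplication by \<open>n\<close> costs one power, so \<open>n log n!\<close> needs one term more.\<close>
  obtain C3 where C3: "\<And>n. n \<ge> 2 \<Longrightarrow>
      \<bar>L n - (\<Sum>k<Suc N. f k / real n ^ (k + 1))\<bar> \<le> C3 / real n ^ (Suc N + 1)"
    using ln_fact_expansion[of "Suc N"] unfolding L_def f_def by blast
  show "\<exists>C :: real. \<forall>n :: nat. n \<ge> 2 \<longrightarrow>
        \<bar>ln (real (binomial_product n)) -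
          (1 / 2 * real n ^ 2 - 1 / 2 * real n * ln (real n)
           + (1 - 1 / 2 * ln (2 * pi)) * real n - 1 / 3 * ln (real n)
           + (- 1 / 2 * ln (2 * pi) - 1 / 12 + 2 * ln glaisher_kinkelin)
           + (\<Sum>j = 1..N. real_of_rat (binomial_product_coeff j) * (1 / real n ^ j)))\<bar>
        \<le> C * (1 / real n ^ (N + 1))"
  proof (intro exI[of _ "2 * C1 + C2 + C3"] allI impI)
    fix n :: nat assume n: "n \<ge> 2"
    have main: "ln (real (binomial_product n)) -
          (1 / 2 * real n ^ 2 - 1 / 2 * real n * ln (real n)
           + (1 - 1 / 2 * ln (2 * pi)) * real n - 1 / 3 * ln (real n)
           + (- 1 / 2 * ln (2 * pi) - 1 / 12 + 2 * ln glaisher_kinkelin)) = 2 * H n - real n * L n - L n + 1 / 12"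
      unfolding ln_binomial_product H_def L_def by (simp add: algebra_simps power2_eq_square)
    \<comment> \<open>The leading term of the Stirling series, multiplied by \<open>n\<close>, is the constant $1/12$.\<close>
    have f0: "f 0 = 1 / 12" by (simp add: f_def bernoulli_number_values of_rat_divide)
    have "real n * (\<Sum>k<Suc N. f k / real n ^ (k + 1)) = (\<Sum>k<Suc N. f k / real n ^ k)"
      using n by (simp add: sum_distrib_left del: sum.lessThan_Suc)
    also have "\<dots> = 1 / 12 + (\<Sum>k<N. f (Suc k) / real n ^ (k + 1))"
      by (simp only: sum.lessThan_Suc_shift f0) simp
    finally have nL: "real n * (\<Sum>k<Suc N. f k / real n ^ (k + 1)) =
        1 / 12 + (\<Sum>k<N. f (Suc k) / real n ^ (k + 1))" .
    have "(\<Sum>j = 1..N. real_of_rat (binomial_product_coeff j) * (1 / real n ^ j)) =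
        (\<Sum>k<N. real_of_rat (binomial_product_coeff (Suc k)) / real n ^ (k + 1))"
      by (simp add: sum.atLeast1_atMost_eq)
    also have "\<dots> = (\<Sum>k<N. (2 * h k - f (Suc k) - f k) / real n ^ (k + 1))"
      by (simp only: binomial_product_coeff_decompose h_def f_def)
    also have "\<dots> = 2 * (\<Sum>k<N. h k / real n ^ (k + 1)) - (\<Sum>k<N. f (Suc k) / real n ^ (k + 1)) -
        (\<Sum>k<N. f k / real n ^ (k + 1))"
      by (simp only: diff_divide_distrib sum_subtractf sum_distrib_left times_divide_eq_right)
    finally have "\<bar>2 * H n - real n * L n - L n + 1 / 12 -
        (\<Sum>j = 1..N. real_of_rat (binomial_product_coeff j) * (1 / real n ^ j))\<bar> =
        \<bar>2 * (H n - (\<Sum>k<N. h k / real n ^ (k + 1))) -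
         real n * (L n - (\<Sum>k<Suc N. f k / real n ^ (k + 1))) -
         (L n - (\<Sum>k<N. f k / real n ^ (k + 1)))\<bar>"
      unfolding right_diff_distrib nL by simp
    also have "\<dots> \<le> 2 * (C1 / real n ^ (N + 1)) + real n * (C3 / real n ^ (Suc N + 1)) + C2 / real n ^ (N + 1)"
    proof -
      have "\<bar>real n * (L n - (\<Sum>k<Suc N. f k / real n ^ (k + 1)))\<bar> \<le> real n * (C3 / real n ^ (Suc N + 1))"
        unfolding abs_mult using mult_left_mono[OF C3[OF n], of "real n"]
        by (simp only: abs_of_nat of_nat_0_le_iff)
      moreover have "\<bar>2 * x - y - z\<bar> \<le> 2 * a + b + c" if "\<bar>x\<bar> \<le> a" "\<bar>y\<bar> \<le> b" "\<bar>z\<bar> \<le> c"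
        for x y z a b c :: real
        using that by linarith
      ultimately show ?thesis using C1[OF n] C2[OF n] by blast
    qed
    also have "\<dots> = (2 * C1 + C2 + C3) * (1 / real n ^ (N + 1))"
      using n by (simp add: field_simps)
    finally show "\<bar>ln (real (binomial_product n)) -
          (1 / 2 * real n ^ 2 - 1 / 2 * real n * ln (real n)
           + (1 - 1 / 2 * ln (2 * pi)) * real n - 1 / 3 * ln (real n)
           + (- 1 / 2 * ln (2 * pi) - 1 / 12 + 2 * ln glaisher_kinkelin)
           + (\<Sum>j = 1..N. real_of_rat (binomial_product_coeff j) * (1 / real n ^ j)))\<bar>
        \<le> (2 * C1 + C2 + C3) * (1 / real n ^ (N + 1))"
      unfolding main [symmetric] by (simp only: diff_diff_eq)
  qed
qed

end
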